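(* Let $H$ be a bialgebra over a field $k$ and let $(H,D)$ be an L-R-admissible pair (as defined in the context). Then the vector space $D\otimes H$, denoted $D\natural H$ with elements $d\otimes h$ written $d\natural h$, endowed with the unit $1_D\natural 1_H$, the multiplication $$(d\natural h)(d'\natural h')=(d\cdot h'_2)(h_1\cdot d')\natural h_2h'_1,$$ the counit $\varepsilon(d\natural h)=\varepsilon_D(d)\varepsilon_H(h)$ and the comultiplication $$\Delta(d\natural h)=(d_1^{<0>}\natural d_2^{(-1)}h_1)\otimes(d_2^{(0)}\natural h_2d_1^{<1>})$$ (for all $d,d'\in D$, $h,h'\in H$) is a bialgebra (called the L-R-smash biproduct of $D$ and $H$).
   Context: Everything is over a field $k$, $\otimes=\otimes_k$. For a bialgebra $H$ write $\Delta(h)=h_1\otimes h_2$ (summation understood) and $\varepsilon_H=\varepsilon$ for its counit. Let $H$ be a bialgebra and $D$ a vector space with the following structures. (i) $D$ is an $H$-bimodule, with actions $h\otimes d\mapsto h\cdot d$ and $d\otimes h\mapsto d\cdot h$. (ii) $D$ is an (associative unital) algebra with unit $1_D$ and multiplication $c\otimes d\mapsto cd$. (iii) $D$ is an $H$-bimodule algebra: $h\cdot 1_D=\varepsilon(h)1_D$, $1_D\cdot h=\varepsilon(h)1_D$, $h\cdot(cd)=(h_1\cdot c)(h_2\cdot d)$, $(cd)\cdot h=(c\cdot h_1)(d\cdot h_2)$ for all $h\in H$, $c,d\in D$. (iv) $D$ is an $H$-bicomodule, with right coaction $\rho:D\to D\otimes H$, $\rho(d)=d^{<0>}\otimes d^{<1>}$,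 and left coaction $\lambda:D\to H\otimes D$, $\lambda(d)=d^{(-1)}\otimes d^{(0)}$. (v) $D$ is a (coassociative counital) coalgebra with comultiplication $\Delta_D(d)=d_1\otimes d_2$ and counit $\varepsilon_D$. (vi) $D$ is an $H$-bicomodule coalgebra: for all $d\in D$, $d_1^{(-1)}d_2^{(-1)}\otimes d_1^{(0)}\otimes d_2^{(0)}=d^{(-1)}\otimes(d^{(0)})_1\otimes(d^{(0)})_2$, $d^{(-1)}\varepsilon_D(d^{(0)})=\varepsilon_D(d)1_H$, $d_1^{<0>}\otimes d_2^{<0>}\otimes d_1^{<1>}d_2^{<1>}=(d^{<0>})_1\otimes(d^{<0>})_2\otimes d^{<1>}$, $\varepsilon_D(d^{<0>})d^{<1>}=\varepsilon_D(d)1_H$. For such $H$ and $D$, with the multiplication and unit in the claim $D\natural H$ is known to be an algebra (the L-R-smash product), and with the comultiplication and counit in the claim it is known to be a coalgebra (the L-R-smash coproduct). $(H,D)$ is called an L-R-admissible pair if (i)–(vi) hold and moreover, for all $h\in H$ and $c,d\in D$: - $\varepsilon_D(1_D)=1$, $\varepsilon_D(cd)=\varepsilon_D(c)\varepsilon_D(d)$; - $\varepsilon_D(h\cdot d)=\varepsilon_D(d\cdot h)=\varepsilon_D(d)\varepsilon_H(h)$; - $\rho(1_D)=1_D\otimes 1_H$, $\lambda(1_D)=1_H\otimes 1_D$; - $\Delta_D(1_D)=1_D\otimes 1_D$; - $\rho(cd)=c^{<0>}d^{<0>}\otimes c^{<1>}d^{<1>}$; - $\lambda(cd)=c^{(-1)}d^{(-1)}\otimes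 c^{(0)}d^{(0)}$; - $\Delta_D(h\cdot d)=h_1\cdot d_1\otimes h_2\cdot d_2$; - $\Delta_D(d\cdot h)=d_1\cdot h_1\otimes d_2\cdot h_2$; - $\Delta_D(cd)=c_1(c_2^{(-1)}\cdot d_1^{<0>})\otimes(c_2^{(0)}\cdot d_1^{<1>})d_2$; - $(h_1\cdot d)^{(-1)}h_2\otimes(h_1\cdot d)^{(0)}=h_1d^{(-1)}\otimes h_2\cdot d^{(0)}$; - $(h\cdot d)^{<0>}\otimes(h\cdot d)^{<1>}=h\cdot d^{<0>}\otimes d^{<1>}$; - $(d\cdot h_2)^{<0>}\otimes h_1(d\cdot h_2)^{<1>}=d^{<0>}\cdot h_1\otimes d^{<1>}h_2$; - $(d\cdot h)^{(-1)}\otimes(d\cdot h)^{(0)}=d^{(-1)}\otimes d^{(0)}\cdot h$; - $c^{<0>}\cdot d^{(-1)}\otimes c^{<1>}\cdot d^{(0)}=c\otimes d$. *)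

theory Defs
  imports Complex_Main "HOL-Library.Function_Algebras"
begin

section \<open>Vector spaces, linear and bilinear maps\<close>

text \<open>A vector space over the field \<open>'k\<close> is a linear subspace of some \<open>'k\<close>-vector space
  living on a whole type. Carriers are needed because a tensor product of two vector spaces is not
  a type of its own: the type would have to depend on the scalar multiplications.\<close>

record ('k, 'v) vspace =
  carrier :: "'v set"
  smult :: "'k \<Rightarrow> 'v \<Rightarrow> 'v"  (infixr "\<cdot>\<^sub>s\<index>" 75)

definition vspace :: "('k::field, 'v::ab_group_add, 'm) vspace_scheme \<Rightarrow> bool" where
  "vspace V \<longleftrightarrow> vector_space (smult V) \<and> module.subspace (smult V) (carrier V)"

definition scalars :: "('k::field, 'k) vspace" where
  "scalars = \<lparr>carrier = UNIV, smult = (*)\<rparr>"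

definition linear_on ::
  "('k::field, 'v::ab_group_add, 'm) vspace_scheme \<Rightarrow> ('k, 'w::ab_group_add, 'n) vspace_scheme
    \<Rightarrow> ('v \<Rightarrow> 'w) \<Rightarrow> bool" where
  "linear_on V W f \<longleftrightarrow>
     (\<forall>x\<in>carrier V. f x \<in> carrier W) \<and>
     (\<forall>x\<in>carrier V. \<forall>y\<in>carrier V. f (x + y) = f x + f y) \<and>
     (\<forall>c. \<forall>x\<in>carrier V. f (c \<cdot>\<^sub>s\<^bsub>V\<^esub> x) = c \<cdot>\<^sub>s\<^bsub>W\<^esub> f x)"

definition bilinear_on ::
  "('k::field, 'v::ab_group_add, 'm) vspace_scheme \<Rightarrow> ('k, 'w::ab_group_add, 'n) vspace_scheme
    \<Rightarrow> ('k, 'x::ab_group_add, 'p) vspace_scheme \<Rightarrow> ('v \<Rightarrow> 'w \<Rightarrow> 'x) \<Rightarrow> bool" where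
  "bilinear_on V W X f \<longleftrightarrow>
     (\<forall>x\<in>carrier V. linear_on W X (f x)) \<and> (\<forall>y\<in>carrier W. linear_on V X (\<lambda>x. f x y))"

section \<open>Tensor products\<close>

text \<open>Over a field, bilinear forms separate the elements of \<open>V \<otimes> W\<close>. We therefore realise
  \<open>V \<otimes> W\<close> inside the functionals on bilinear forms: \<open>x \<otimes> y\<close> is evaluation at \<open>(x, y)\<close>,
  and \<open>V \<otimes> W\<close> is the span of these. The universal property is proved below
  (\<open>sweedler_tens\<close>, \<open>linear_on_sweedler\<close>, \<open>linear_on_tensor_eqI\<close>). Iterated tensor products
  are always bracketed to the right.\<close>

type_synonym ('k, 'v, 'w) tensor = "('v \<Rightarrow> 'w \<Rightarrow> 'k) \<Rightarrow> 'k"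

definition tens ::
  "('k::field, 'v::ab_group_add, 'm) vspace_scheme \<Rightarrow> ('k, 'w::ab_group_add, 'n) vspace_scheme
    \<Rightarrow> 'v \<Rightarrow> 'w \<Rightarrow> ('k, 'v, 'w) tensor" where
  "tens V W x y = (\<lambda>\<beta>. if bilinear_on V W scalars \<beta> then \<beta> x y else 0)"

definition tscale :: "'k::field \<Rightarrow> ('k, 'v, 'w) tensor \<Rightarrow> ('k, 'v, 'w) tensor" where
  "tscale c t = (\<lambda>\<beta>. c * t \<beta>)"

definition tensor_space ::
  "('k::field, 'v::ab_group_add, 'm) vspace_scheme \<Rightarrow> ('k, 'w::ab_group_add, 'n) vspace_scheme
    \<Rightarrow> ('k, ('k, 'v, 'w) tensor) vspace"  (infixr "\<Otimes>" 70) where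
  "V \<Otimes> W = \<lparr>carrier = module.span tscale {tens V W x y | x y. x \<in> carrier V \<and> y \<in> carrier W},
            smult = tscale\<rparr>"

text \<open>Sweedler notation: if \<open>t = \<Sum>\<^sub>i x\<^sub>i \<otimes> y\<^sub>i\<close>, then \<open>sweedler V W t f = \<Sum>\<^sub>i f x\<^sub>i y\<^sub>i\<close>. For
  bilinear \<open>f\<close> this does not depend on the chosen representation of \<open>t\<close>; it is the value at
  \<open>t\<close> of the linear map on \<open>V \<otimes> W\<close> induced by \<open>f\<close>.\<close>

definition tensor_rep ::
  "('k::field, 'v::ab_group_add, 'm) vspace_scheme \<Rightarrow> ('k, 'w::ab_group_add, 'n) vspace_scheme
    \<Rightarrow> ('k, 'v, 'w) tensor \<Rightarrow> ('v \<times> 'w) list" where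
  "tensor_rep V W t =
     (SOME xs. set xs \<subseteq> carrier V \<times> carrier W \<and> t = (\<Sum>(x, y)\<leftarrow>xs. tens V W x y))"

definition sweedler ::
  "('k::field, 'v::ab_group_add, 'm) vspace_scheme \<Rightarrow> ('k, 'w::ab_group_add, 'n) vspace_scheme
    \<Rightarrow> ('k, 'v, 'w) tensor \<Rightarrow> ('v \<Rightarrow> 'w \<Rightarrow> 'x::ab_group_add) \<Rightarrow> 'x" where
  "sweedler V W t f = (\<Sum>(x, y)\<leftarrow>tensor_rep V W t. f x y)"

subsection \<open>The universal property\<close>

lemma vector_space_tscale: "vector_space (tscale :: 'k::field \<Rightarrow> ('k, 'v, 'w) tensor \<Rightarrow> _)"
  by unfold_locales (auto simp: tscale_def fun_eq_iff algebra_simps)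

interpretation tensor: vector_space "tscale :: 'k::field \<Rightarrow> ('k, 'v, 'w) tensor \<Rightarrow> _"
  by (rule vector_space_tscale)

lemma vspace_tensor_space [simp]: "vspace (V \<Otimes> W)"
  by (simp add: vspace_def tensor_space_def vector_space_tscale)

lemma vspace_scalars [simp]: "vspace (scalars :: ('k::field, 'k) vspace)"
proof -
  interpret vector_space "(*) :: 'k \<Rightarrow> _"
    by unfold_locales (auto simp: algebra_simps)
  show ?thesis
    by (simp add: vspace_def scalars_def vector_space_axioms)
qed

lemma
  assumes "vspace V"
  shows vspace_0: "0 \<in> carrier V"
    and vspace_add: "x \<in> carrier V \<Longrightarrow> y \<in> carrier V \<Longrightarrow> x + y \<in> carrier V"
    and vspace_smult: "x \<in> carrier V \<Longrightarrow> c \<cdot>\<^sub>s\<^bsub>V\<^esub> x \<in> carrier V"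
    and smult_add_right: "c \<cdot>\<^sub>s\<^bsub>V\<^esub> (x + y) = c \<cdot>\<^sub>s\<^bsub>V\<^esub> x + c \<cdot>\<^sub>s\<^bsub>V\<^esub> y"
    and smult_add_left: "(c + d) \<cdot>\<^sub>s\<^bsub>V\<^esub> x = c \<cdot>\<^sub>s\<^bsub>V\<^esub> x + d \<cdot>\<^sub>s\<^bsub>V\<^esub> x"
    and smult_smult: "c \<cdot>\<^sub>s\<^bsub>V\<^esub> (d \<cdot>\<^sub>s\<^bsub>V\<^esub> x) = (c * d) \<cdot>\<^sub>s\<^bsub>V\<^esub> x"
    and smult_one: "1 \<cdot>\<^sub>s\<^bsub>V\<^esub> x = x"
    and smult_0: "c \<cdot>\<^sub>s\<^bsub>V\<^esub> 0 = 0"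
proof -
  interpret vector_space "smult V" using assms by (simp add: vspace_def)
  have S: "subspace (carrier V)" using assms by (simp add: vspace_def)
  show "0 \<in> carrier V" and "x \<in> carrier V \<Longrightarrow> y \<in> carrier V \<Longrightarrow> x + y \<in> carrier V"
    and "x \<in> carrier V \<Longrightarrow> c \<cdot>\<^sub>s\<^bsub>V\<^esub> x \<in> carrier V"
    using S by (auto simp: subspace_def)
  show "c \<cdot>\<^sub>s\<^bsub>V\<^esub> (x + y) = c \<cdot>\<^sub>s\<^bsub>V\<^esub> x + c \<cdot>\<^sub>s\<^bsub>V\<^esub> y" "(c + d) \<cdot>\<^sub>s\<^bsub>V\<^esub> x = c \<cdot>\<^sub>s\<^bsub>V\<^esub> x + d \<cdot>\<^sub>s\<^bsub>V\<^esub> x"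
    "c \<cdot>\<^sub>s\<^bsub>V\<^esub> (d \<cdot>\<^sub>s\<^bsub>V\<^esub> x) = (c * d) \<cdot>\<^sub>s\<^bsub>V\<^esub> x" "1 \<cdot>\<^sub>s\<^bsub>V\<^esub> x = x" "c \<cdot>\<^sub>s\<^bsub>V\<^esub> 0 = 0"
    by (simp_all add: scale_right_distrib scale_left_distrib)
qed

lemma linear_onD:
  assumes "linear_on V W f"
  shows "x \<in> carrier V \<Longrightarrow> f x \<in> carrier W"
    and "x \<in> carrier V \<Longrightarrow> y \<in> carrier V \<Longrightarrow> f (x + y) = f x + f y"
    and "x \<in> carrier V \<Longrightarrow> f (c \<cdot>\<^sub>s\<^bsub>V\<^esub> x) = c \<cdot>\<^sub>s\<^bsub>W\<^esub> f x"
  using assms by (auto simp: linear_on_def)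

lemma linear_on_0:
  assumes "vspace V" "linear_on V W f"
  shows "f 0 = 0"
  using linear_onD(2)[OF assms(2), of 0 0] vspace_0[OF assms(1)] by simp

lemma bilinear_onD1: "bilinear_on V W X f \<Longrightarrow> x \<in> carrier V \<Longrightarrow> linear_on W X (f x)"
  and bilinear_onD2: "bilinear_on V W X f \<Longrightarrow> y \<in> carrier W \<Longrightarrow> linear_on V X (\<lambda>x. f x y)"
  by (auto simp: bilinear_on_def)

lemma bilinear_onD: "bilinear_on V W X f \<Longrightarrow> x \<in> carrier V \<Longrightarrow> y \<in> carrier W \<Longrightarrow> f x y \<in> carrier X"
  by (auto simp: bilinear_on_def linear_on_def)

lemma bilinear_on_tens:
  assumes "vspace V" "vspace W"
  shows "bilinear_on V W (V \<Otimes> W) (tens V W)"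
proof -
  have "tens V W x y \<in> carrier (V \<Otimes> W)" if "x \<in> carrier V" "y \<in> carrier W" for x y
    using that by (auto simp: tensor_space_def intro: tensor.span_base)
  moreover have "smult (V \<Otimes> W) = tscale" by (simp add: tensor_space_def)
  ultimately show ?thesis
    by (auto simp: bilinear_on_def linear_on_def tens_def fun_eq_iff tscale_def scalars_def)
qed

lemma sum_list_in_carrier:
  assumes "vspace V" "\<And>x. x \<in> set xs \<Longrightarrow> f x \<in> carrier V"
  shows "sum_list (map f xs) \<in> carrier V"
  using assms(2) by (induction xs) (auto simp: vspace_0[OF assms(1)] vspace_add[OF assms(1)])

lemma linear_on_sum_list:
  assumes V: "vspace V" and f: "linear_on V W f" and "\<And>x. x \<in> set xs \<Longrightarrow> g x \<in> carrier V"
  shows "f (sum_list (map g xs)) = sum_list (map (\<lambda>x. f (g x)) xs)"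
  using assms(3)
  by (induction xs)
    (auto simp: linear_on_0[OF V f] linear_onD(2)[OF f] sum_list_in_carrier[OF V])

lemma ex_tensor_rep:
  assumes V: "vspace V" and W: "vspace W" and "t \<in> carrier (V \<Otimes> W)"
  shows "\<exists>xs. set xs \<subseteq> carrier V \<times> carrier W \<and> t = (\<Sum>(x, y)\<leftarrow>xs. tens V W x y)"
proof -
  have "t \<in> tensor.span {tens V W x y | x y. x \<in> carrier V \<and> y \<in> carrier W}"
    using assms(3) by (simp add: tensor_space_def)
  then show ?thesis
  proof (induction rule: tensor.span_induct_alt)
    case base
    show ?case by (rule exI[of _ "[]"]) simp
  next
    case (step c u t)
    then obtain x y xs where u: "u = tens V W x y" "x \<in> carrier V" "y \<in> carrier W"
      and xs: "set xs \<subseteq> carrier V \<times> carrier W" "t = (\<Sum>(x, y)\<leftarrow>xs. tens V W x y)"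
      by auto
    have "tscale c u = tens V W (c \<cdot>\<^sub>s\<^bsub>V\<^esub> x) y"
      using linear_onD(3)[OF bilinear_onD2[OF bilinear_on_tens[OF V W] u(3)] u(2)] u(1)
      by (simp add: tensor_space_def)
    with u xs show ?case
      by (intro exI[of _ "(c \<cdot>\<^sub>s\<^bsub>V\<^esub> x, y) # xs"]) (auto simp: vspace_smult[OF V])
  qed
qed

lemma tensor_rep:
  assumes "vspace V" "vspace W" "t \<in> carrier (V \<Otimes> W)"
  shows "set (tensor_rep V W t) \<subseteq> carrier V \<times> carrier W"
    and "(\<Sum>(x, y)\<leftarrow>tensor_rep V W t. tens V W x y) = t"
  using someI_ex[OF ex_tensor_rep[OF assms]] unfolding tensor_rep_def by auto

lemma functional_separates:
  assumes X: "vspace (X :: ('k::field, 'x::ab_group_add, 'm) vspace_scheme)" and "v \<noteq> 0"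
  shows "\<exists>\<phi>. linear_on X scalars \<phi> \<and> (\<forall>x y. \<phi> (x + y) = \<phi> x + \<phi> y) \<and> \<phi> v \<noteq> 0"
proof -
  interpret A: vector_space "smult X" using X by (simp add: vspace_def)
  interpret B: vector_space "(*) :: 'k \<Rightarrow> _"
    by unfold_locales (auto simp: algebra_simps)
  interpret vector_space_pair "smult X" "(*) :: 'k \<Rightarrow> _" ..
  have "A.independent {v}" using assms(2) by simp
  from linear_independent_extend[OF this, of "\<lambda>_. 1"] obtain \<phi> where
    \<phi>: "Vector_Spaces.linear (smult X) (*) \<phi>" "\<phi> v = 1" by auto
  from \<phi>(1) interpret Vector_Spaces.linear "smult X" "(*)" \<phi> .
  show ?thesis
    by (rule exI[of _ \<phi>]) (auto simp: linear_on_def scalars_def add scale \<phi>(2))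
qed

lemma linear_on_compose:
  "linear_on V W f \<Longrightarrow> linear_on W X g \<Longrightarrow> linear_on V X (\<lambda>x. g (f x))"
  by (auto simp: linear_on_def)

lemma sum_tens_eqD:
  assumes X: "vspace X" and f: "bilinear_on V W X f"
    and xs: "set xs \<subseteq> carrier V \<times> carrier W" and ys: "set ys \<subseteq> carrier V \<times> carrier W"
    and eq: "(\<Sum>(x, y)\<leftarrow>xs. tens V W x y) = (\<Sum>(x, y)\<leftarrow>ys. tens V W x y)"
  shows "(\<Sum>(x, y)\<leftarrow>xs. f x y) = (\<Sum>(x, y)\<leftarrow>ys. f x y)"
proof (rule ccontr)
  let ?S = "\<lambda>zs. \<Sum>(x, y)\<leftarrow>zs. f x y"
  assume "?S xs \<noteq> ?S ys"
  with functional_separates[OF X, of "?S xs - ?S ys"] obtain \<phi> where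
    \<phi>: "linear_on X scalars \<phi>" "\<And>x y. \<phi> (x + y) = \<phi> x + \<phi> y" "\<phi> (?S xs - ?S ys) \<noteq> 0"
    by auto
  define \<beta> where "\<beta> = (\<lambda>x y. \<phi> (f x y))"
  have \<beta>: "bilinear_on V W scalars \<beta>"
    using f by (auto simp: bilinear_on_def \<beta>_def intro!: linear_on_compose[OF _ \<phi>(1)])
  have ev: "(\<Sum>(x, y)\<leftarrow>zs. tens V W x y) \<beta> = \<phi> (?S zs)"
    if "set zs \<subseteq> carrier V \<times> carrier W" for zs
  proof -
    have *: "\<phi> (?S zs) = (\<Sum>(x, y)\<leftarrow>zs. \<beta> x y)"
      using that
      by (subst linear_on_sum_list[OF X \<phi>(1)])
        (auto simp: \<beta>_def case_prod_unfold intro!: bilinear_onD[OF f])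
    show ?thesis
      unfolding * by (induction zs) (auto simp: tens_def \<beta>)
  qed
  have "\<phi> (?S xs) = \<phi> (?S ys)"
    using ev[OF xs] ev[OF ys] eq by simp
  moreover have "\<phi> (?S xs) = \<phi> (?S xs - ?S ys) + \<phi> (?S ys)"
    using \<phi>(2)[of "?S xs - ?S ys" "?S ys"] by simp
  ultimately show False using \<phi>(3) by simp
qed

lemma sweedler_eq_sum:
  assumes V: "vspace V" and W: "vspace W" and X: "vspace X" and f: "bilinear_on V W X f"
    and xs: "set xs \<subseteq> carrier V \<times> carrier W" and t: "t = (\<Sum>(x, y)\<leftarrow>xs. tens V W x y)"
  shows "sweedler V W t f = (\<Sum>(x, y)\<leftarrow>xs. f x y)"
proof -
  have "t \<in> carrier (V \<Otimes> W)"
    unfolding t using xs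
    by (intro sum_list_in_carrier[OF vspace_tensor_space])
      (auto intro!: linear_onD(1)[OF bilinear_onD1[OF bilinear_on_tens[OF V W]]])
  note r = tensor_rep[OF V W this]
  show ?thesis
    unfolding sweedler_def by (rule sum_tens_eqD[OF X f r(1) xs]) (simp only: r(2) flip: t)
qed

lemma sweedler_tens:
  assumes "vspace V" "vspace W" "vspace X" "bilinear_on V W X f" "x \<in> carrier V" "y \<in> carrier W"
  shows "sweedler V W (tens V W x y) f = f x y"
  using sweedler_eq_sum[OF assms(1-4), of "[(x, y)]"] assms(5,6) by simp

lemma linear_on_sweedler:
  assumes V: "vspace V" and W: "vspace W" and X: "vspace X" and f: "bilinear_on V W X f"
  shows "linear_on (V \<Otimes> W) X (\<lambda>t. sweedler V W t f)"
  unfolding linear_on_def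
proof (intro conjI ballI allI)
  fix t assume t: "t \<in> carrier (V \<Otimes> W)"
  note rt = tensor_rep[OF V W t]
  show "sweedler V W t f \<in> carrier X"
    unfolding sweedler_def using rt(1)
    by (intro sum_list_in_carrier[OF X]) (auto intro: linear_onD(1)[OF bilinear_onD1[OF f]])
  fix c
  let ?m = "\<lambda>(x, y). (c \<cdot>\<^sub>s\<^bsub>V\<^esub> x, y)"
  have B: "(\<Sum>(x, y)\<leftarrow>map ?m zs. g x y) = c \<cdot>\<^sub>s\<^bsub>Y\<^esub> (\<Sum>(x, y)\<leftarrow>zs. g x y)"
    if "vspace Y" "bilinear_on V W Y g" "set zs \<subseteq> carrier V \<times> carrier W"
    for Y :: "('a, 'y::ab_group_add, 'q) vspace_scheme" and g zs
    using that(3)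
    by (induction zs)
      (auto simp: smult_0[OF that(1)] smult_add_right[OF that(1)]
         linear_onD(3)[OF bilinear_onD2[OF that(2)]])
  have "sweedler V W (c \<cdot>\<^sub>s\<^bsub>V \<Otimes> W\<^esub> t) f = (\<Sum>(x, y)\<leftarrow>map ?m (tensor_rep V W t). f x y)"
  proof (rule sweedler_eq_sum[OF V W X f])
    show "set (map ?m (tensor_rep V W t)) \<subseteq> carrier V \<times> carrier W"
      using rt(1) by (auto simp: vspace_smult[OF V])
    show "c \<cdot>\<^sub>s\<^bsub>V \<Otimes> W\<^esub> t = (\<Sum>(x, y)\<leftarrow>map ?m (tensor_rep V W t). tens V W x y)"
      unfolding B[OF vspace_tensor_space bilinear_on_tens[OF V W] rt(1)] rt(2) ..
  qed
  then show "sweedler V W (c \<cdot>\<^sub>s\<^bsub>V \<Otimes> W\<^esub> t) f = c \<cdot>\<^sub>s\<^bsub>X\<^esub> sweedler V W t f"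
    unfolding B[OF X f rt(1)] sweedler_def .
next
  fix s t assume s: "s \<in> carrier (V \<Otimes> W)" and t: "t \<in> carrier (V \<Otimes> W)"
  note r = tensor_rep[OF V W s] tensor_rep[OF V W t]
  show "sweedler V W (s + t) f = sweedler V W s f + sweedler V W t f"
    using sweedler_eq_sum[OF V W X f, of "tensor_rep V W s @ tensor_rep V W t" "s + t"] r
    by (simp add: sweedler_def)
qed

lemma linear_on_tensor_eqI:
  assumes V: "vspace V" and W: "vspace W"
    and f: "linear_on (V \<Otimes> W) X f" and g: "linear_on (V \<Otimes> W) X g"
    and eq: "\<And>x y. x \<in> carrier V \<Longrightarrow> y \<in> carrier W \<Longrightarrow> f (tens V W x y) = g (tens V W x y)"
    and t: "t \<in> carrier (V \<Otimes> W)"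
  shows "f t = g t"
proof -
  note r = tensor_rep[OF V W t]
  have *: "h t = (\<Sum>(x, y)\<leftarrow>tensor_rep V W t. h (tens V W x y))" if "linear_on (V \<Otimes> W) X h" for h
    using r(1)
    by (subst r(2)[symmetric], subst linear_on_sum_list[OF vspace_tensor_space that])
      (auto simp: case_prod_unfold intro!: linear_onD(1)[OF bilinear_onD1[OF bilinear_on_tens[OF V W]]])
  show ?thesis
    unfolding *[OF f] *[OF g] using r(1) eq by (intro arg_cong[where f = sum_list] map_cong) auto
qed

section \<open>Algebras, coalgebras and bialgebras\<close>

record ('k, 'v) alg_coalg = "('k, 'v) vspace" +
  mult :: "'v \<Rightarrow> 'v \<Rightarrow> 'v"  (infixl "\<cdot>\<index>" 70)
  one :: "'v"  ("\<one>\<index>")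
  comult :: "'v \<Rightarrow> ('k, 'v, 'v) tensor"  ("\<Delta>\<index>")
  counit :: "'v \<Rightarrow> 'k"  ("\<epsilon>\<index>")

definition algebra :: "('k::field, 'v::ab_group_add) alg_coalg \<Rightarrow> bool" where
  "algebra A \<longleftrightarrow> vspace A \<and> bilinear_on A A A (mult A) \<and> \<one>\<^bsub>A\<^esub> \<in> carrier A \<and>
     (\<forall>x\<in>carrier A. \<forall>y\<in>carrier A. \<forall>z\<in>carrier A.
        (x \<cdot>\<^bsub>A\<^esub> y) \<cdot>\<^bsub>A\<^esub> z = x \<cdot>\<^bsub>A\<^esub> (y \<cdot>\<^bsub>A\<^esub> z)) \<and>
     (\<forall>x\<in>carrier A. \<one>\<^bsub>A\<^esub> \<cdot>\<^bsub>A\<^esub> x = x \<and> x \<cdot>\<^bsub>A\<^esub> \<one>\<^bsub>A\<^esub> = x)"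

definition coalgebra :: "('k::field, 'v::ab_group_add) alg_coalg \<Rightarrow> bool" where
  "coalgebra C \<longleftrightarrow> vspace C \<and> linear_on C (C \<Otimes> C) \<Delta>\<^bsub>C\<^esub> \<and> linear_on C scalars \<epsilon>\<^bsub>C\<^esub> \<and>
     (\<forall>x\<in>carrier C.
        sweedler C C (\<Delta>\<^bsub>C\<^esub> x) (\<lambda>y z. sweedler C C (\<Delta>\<^bsub>C\<^esub> y) (\<lambda>y\<^sub>1 y\<^sub>2.
          tens C (C \<Otimes> C) y\<^sub>1 (tens C C y\<^sub>2 z))) =
        sweedler C C (\<Delta>\<^bsub>C\<^esub> x) (\<lambda>y z. sweedler C C (\<Delta>\<^bsub>C\<^esub> z) (\<lambda>z\<^sub>1 z\<^sub>2.
          tens C (C \<Otimes> C) y (tens C C z\<^sub>1 z\<^sub>2)))) \<and>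
     (\<forall>x\<in>carrier C.
        sweedler C C (\<Delta>\<^bsub>C\<^esub> x) (\<lambda>y z. \<epsilon>\<^bsub>C\<^esub> y \<cdot>\<^sub>s\<^bsub>C\<^esub> z) = x \<and>
        sweedler C C (\<Delta>\<^bsub>C\<^esub> x) (\<lambda>y z. \<epsilon>\<^bsub>C\<^esub> z \<cdot>\<^sub>s\<^bsub>C\<^esub> y) = x)"

definition bialgebra :: "('k::field, 'v::ab_group_add) alg_coalg \<Rightarrow> bool" where
  "bialgebra B \<longleftrightarrow> algebra B \<and> coalgebra B \<and>
     \<Delta>\<^bsub>B\<^esub> \<one>\<^bsub>B\<^esub> = tens B B \<one>\<^bsub>B\<^esub> \<one>\<^bsub>B\<^esub> \<and> \<epsilon>\<^bsub>B\<^esub> \<one>\<^bsub>B\<^esub> = 1 \<and>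
     (\<forall>x\<in>carrier B. \<forall>y\<in>carrier B.
        \<epsilon>\<^bsub>B\<^esub> (x \<cdot>\<^bsub>B\<^esub> y) = \<epsilon>\<^bsub>B\<^esub> x * \<epsilon>\<^bsub>B\<^esub> y \<and>
        \<Delta>\<^bsub>B\<^esub> (x \<cdot>\<^bsub>B\<^esub> y) =
          sweedler B B (\<Delta>\<^bsub>B\<^esub> x) (\<lambda>x\<^sub>1 x\<^sub>2. sweedler B B (\<Delta>\<^bsub>B\<^esub> y) (\<lambda>y\<^sub>1 y\<^sub>2.
            tens B B (x\<^sub>1 \<cdot>\<^bsub>B\<^esub> y\<^sub>1) (x\<^sub>2 \<cdot>\<^bsub>B\<^esub> y\<^sub>2))))"

section \<open>Bimodule algebras and bicomodule coalgebras\<close>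

locale bimodule =
  fixes H :: "('k::field, 'h::ab_group_add) alg_coalg"
    and D :: "('k, 'd::ab_group_add) alg_coalg"
    and lact :: "'h \<Rightarrow> 'd \<Rightarrow> 'd"  (infixr "\<rhd>" 75)
    and ract :: "'d \<Rightarrow> 'h \<Rightarrow> 'd"  (infixl "\<lhd>" 75)
  assumes bialgebra_H: "bialgebra H"
    and vspace_D: "vspace D"
    and bilinear_lact: "bilinear_on H D D (\<rhd>)"
    and bilinear_ract: "bilinear_on D H D (\<lhd>)"
    and one_lact: "d \<in> carrier D \<Longrightarrow> \<one>\<^bsub>H\<^esub> \<rhd> d = d"
    and ract_one: "d \<in> carrier D \<Longrightarrow> d \<lhd> \<one>\<^bsub>H\<^esub> = d"
    and mult_lact: "g \<in> carrier H \<Longrightarrow> h \<in> carrier H \<Longrightarrow> d \<in> carrier D \<Longrightarrow>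
      (g \<cdot>\<^bsub>H\<^esub> h) \<rhd> d = g \<rhd> (h \<rhd> d)"
    and ract_mult: "g \<in> carrier H \<Longrightarrow> h \<in> carrier H \<Longrightarrow> d \<in> carrier D \<Longrightarrow>
      d \<lhd> (g \<cdot>\<^bsub>H\<^esub> h) = (d \<lhd> g) \<lhd> h"
    and lact_ract: "g \<in> carrier H \<Longrightarrow> h \<in> carrier H \<Longrightarrow> d \<in> carrier D \<Longrightarrow>
      (g \<rhd> d) \<lhd> h = g \<rhd> (d \<lhd> h)"

locale bimodule_algebra = bimodule +
  assumes algebra_D: "algebra D"
    and lact_unit: "h \<in> carrier H \<Longrightarrow> h \<rhd> \<one>\<^bsub>D\<^esub> = \<epsilon>\<^bsub>H\<^esub> h \<cdot>\<^sub>s\<^bsub>D\<^esub> \<one>\<^bsub>D\<^esub>"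
    and unit_ract: "h \<in> carrier H \<Longrightarrow> \<one>\<^bsub>D\<^esub> \<lhd> h = \<epsilon>\<^bsub>H\<^esub> h \<cdot>\<^sub>s\<^bsub>D\<^esub> \<one>\<^bsub>D\<^esub>"
    and lact_mult: "h \<in> carrier H \<Longrightarrow> c \<in> carrier D \<Longrightarrow> d \<in> carrier D \<Longrightarrow>
      h \<rhd> (c \<cdot>\<^bsub>D\<^esub> d) = sweedler H H (\<Delta>\<^bsub>H\<^esub> h) (\<lambda>h\<^sub>1 h\<^sub>2. (h\<^sub>1 \<rhd> c) \<cdot>\<^bsub>D\<^esub> (h\<^sub>2 \<rhd> d))"
    and mult_ract: "h \<in> carrier H \<Longrightarrow> c \<in> carrier D \<Longrightarrow> d \<in> carrier D \<Longrightarrow>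
      (c \<cdot>\<^bsub>D\<^esub> d) \<lhd> h = sweedler H H (\<Delta>\<^bsub>H\<^esub> h) (\<lambda>h\<^sub>1 h\<^sub>2. (c \<lhd> h\<^sub>1) \<cdot>\<^bsub>D\<^esub> (d \<lhd> h\<^sub>2))"

text \<open>In what follows \<open>rho\<close> is the right coaction \<open>d \<mapsto> d\<^sup><\<^sup>0\<^sup>> \<otimes> d\<^sup><\<^sup>1\<^sup>>\<close> and \<open>lam\<close> the left coaction
  \<open>d \<mapsto> d\<^sup>(\<^sup>-\<^sup>1\<^sup>) \<otimes> d\<^sup>(\<^sup>0\<^sup>)\<close>.\<close>

locale bicomodule =
  fixes H :: "('k::field, 'h::ab_group_add) alg_coalg"
    and D :: "('k, 'd::ab_group_add) alg_coalg"
    and rho :: "'d \<Rightarrow> ('k, 'd, 'h) tensor"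
    and lam :: "'d \<Rightarrow> ('k, 'h, 'd) tensor"
  assumes bialgebra_H: "bialgebra H"
    and vspace_D: "vspace D"
    and linear_rho: "linear_on D (D \<Otimes> H) rho"
    and linear_lam: "linear_on D (H \<Otimes> D) lam"
    and rho_counit: "d \<in> carrier D \<Longrightarrow>
      sweedler D H (rho d) (\<lambda>a h. \<epsilon>\<^bsub>H\<^esub> h \<cdot>\<^sub>s\<^bsub>D\<^esub> a) = d"
    and lam_counit: "d \<in> carrier D \<Longrightarrow>
      sweedler H D (lam d) (\<lambda>h a. \<epsilon>\<^bsub>H\<^esub> h \<cdot>\<^sub>s\<^bsub>D\<^esub> a) = d"
    and rho_coassoc: "d \<in> carrier D \<Longrightarrow>
      sweedler D H (rho d) (\<lambda>a h. sweedler D H (rho a) (\<lambda>b g.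
        tens D (H \<Otimes> H) b (tens H H g h))) =
      sweedler D H (rho d) (\<lambda>a h. sweedler H H (\<Delta>\<^bsub>H\<^esub> h) (\<lambda>h\<^sub>1 h\<^sub>2.
        tens D (H \<Otimes> H) a (tens H H h\<^sub>1 h\<^sub>2)))"
    and lam_coassoc: "d \<in> carrier D \<Longrightarrow>
      sweedler H D (lam d) (\<lambda>h a. sweedler H H (\<Delta>\<^bsub>H\<^esub> h) (\<lambda>h\<^sub>1 h\<^sub>2.
        tens H (H \<Otimes> D) h\<^sub>1 (tens H D h\<^sub>2 a))) =
      sweedler H D (lam d) (\<lambda>h a. sweedler H D (lam a) (\<lambda>g b.
        tens H (H \<Otimes> D) h (tens H D g b)))"
    and rho_lam: "d \<in> carrier D \<Longrightarrow>
      sweedler D H (rho d) (\<lambda>a h. sweedler H D (lam a) (\<lambda>g b.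
        tens H (D \<Otimes> H) g (tens D H b h))) =
      sweedler H D (lam d) (\<lambda>g a. sweedler D H (rho a) (\<lambda>b h.
        tens H (D \<Otimes> H) g (tens D H b h)))"

locale bicomodule_coalgebra = bicomodule +
  assumes coalgebra_D: "coalgebra D"
    and lam_comult: "d \<in> carrier D \<Longrightarrow>
      sweedler D D (\<Delta>\<^bsub>D\<^esub> d) (\<lambda>d\<^sub>1 d\<^sub>2.
        sweedler H D (lam d\<^sub>1) (\<lambda>g a. sweedler H D (lam d\<^sub>2) (\<lambda>h b.
          tens H (D \<Otimes> D) (g \<cdot>\<^bsub>H\<^esub> h) (tens D D a b)))) =
      sweedler H D (lam d) (\<lambda>h a. sweedler D D (\<Delta>\<^bsub>D\<^esub> a) (\<lambda>a\<^sub>1 a\<^sub>2.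
        tens H (D \<Otimes> D) h (tens D D a\<^sub>1 a\<^sub>2)))"
    and lam_counit_D: "d \<in> carrier D \<Longrightarrow>
      sweedler H D (lam d) (\<lambda>h a. \<epsilon>\<^bsub>D\<^esub> a \<cdot>\<^sub>s\<^bsub>H\<^esub> h) = \<epsilon>\<^bsub>D\<^esub> d \<cdot>\<^sub>s\<^bsub>H\<^esub> \<one>\<^bsub>H\<^esub>"
    and rho_comult: "d \<in> carrier D \<Longrightarrow>
      sweedler D D (\<Delta>\<^bsub>D\<^esub> d) (\<lambda>d\<^sub>1 d\<^sub>2.
        sweedler D H (rho d\<^sub>1) (\<lambda>a g. sweedler D H (rho d\<^sub>2) (\<lambda>b h.
          tens D (D \<Otimes> H) a (tens D H b (g \<cdot>\<^bsub>H\<^esub> h))))) =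
      sweedler D H (rho d) (\<lambda>a h. sweedler D D (\<Delta>\<^bsub>D\<^esub> a) (\<lambda>a\<^sub>1 a\<^sub>2.
        tens D (D \<Otimes> H) a\<^sub>1 (tens D H a\<^sub>2 h)))"
    and rho_counit_D: "d \<in> carrier D \<Longrightarrow>
      sweedler D H (rho d) (\<lambda>a h. \<epsilon>\<^bsub>D\<^esub> a \<cdot>\<^sub>s\<^bsub>H\<^esub> h) = \<epsilon>\<^bsub>D\<^esub> d \<cdot>\<^sub>s\<^bsub>H\<^esub> \<one>\<^bsub>H\<^esub>"

section \<open>L-R-admissible pairs and the L-R-smash biproduct\<close>

locale LR_admissible_pair =
  bimodule_algebra H D lact ract + bicomodule_coalgebra H D rho lam
  for H :: "('k::field, 'h::ab_group_add) alg_coalg"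
    and D :: "('k, 'd::ab_group_add) alg_coalg"
    and lact :: "'h \<Rightarrow> 'd \<Rightarrow> 'd"  (infixr "\<rhd>" 75)
    and ract :: "'d \<Rightarrow> 'h \<Rightarrow> 'd"  (infixl "\<lhd>" 75)
    and rho :: "'d \<Rightarrow> ('k, 'd, 'h) tensor"
    and lam :: "'d \<Rightarrow> ('k, 'h, 'd) tensor" +
  assumes counit_one: "\<epsilon>\<^bsub>D\<^esub> \<one>\<^bsub>D\<^esub> = 1"
    and counit_mult: "c \<in> carrier D \<Longrightarrow> d \<in> carrier D \<Longrightarrow> \<epsilon>\<^bsub>D\<^esub> (c \<cdot>\<^bsub>D\<^esub> d) = \<epsilon>\<^bsub>D\<^esub> c * \<epsilon>\<^bsub>D\<^esub> d"
    and counit_lact: "h \<in> carrier H \<Longrightarrow> d \<in> carrier D \<Longrightarrow> \<epsilon>\<^bsub>D\<^esub> (h \<rhd> d) = \<epsilon>\<^bsub>D\<^esub> d * \<epsilon>\<^bsub>H\<^esub> h"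
    and counit_ract: "h \<in> carrier H \<Longrightarrow> d \<in> carrier D \<Longrightarrow> \<epsilon>\<^bsub>D\<^esub> (d \<lhd> h) = \<epsilon>\<^bsub>D\<^esub> d * \<epsilon>\<^bsub>H\<^esub> h"
    and rho_one: "rho \<one>\<^bsub>D\<^esub> = tens D H \<one>\<^bsub>D\<^esub> \<one>\<^bsub>H\<^esub>"
    and lam_one: "lam \<one>\<^bsub>D\<^esub> = tens H D \<one>\<^bsub>H\<^esub> \<one>\<^bsub>D\<^esub>"
    and comult_one: "\<Delta>\<^bsub>D\<^esub> \<one>\<^bsub>D\<^esub> = tens D D \<one>\<^bsub>D\<^esub> \<one>\<^bsub>D\<^esub>"
    and rho_mult: "c \<in> carrier D \<Longrightarrow> d \<in> carrier D \<Longrightarrow>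
      rho (c \<cdot>\<^bsub>D\<^esub> d) =
      sweedler D H (rho c) (\<lambda>a g. sweedler D H (rho d) (\<lambda>b h.
        tens D H (a \<cdot>\<^bsub>D\<^esub> b) (g \<cdot>\<^bsub>H\<^esub> h)))"
    and lam_mult: "c \<in> carrier D \<Longrightarrow> d \<in> carrier D \<Longrightarrow>
      lam (c \<cdot>\<^bsub>D\<^esub> d) =
      sweedler H D (lam c) (\<lambda>g a. sweedler H D (lam d) (\<lambda>h b.
        tens H D (g \<cdot>\<^bsub>H\<^esub> h) (a \<cdot>\<^bsub>D\<^esub> b)))"
    and comult_lact: "h \<in> carrier H \<Longrightarrow> d \<in> carrier D \<Longrightarrow>
      \<Delta>\<^bsub>D\<^esub> (h \<rhd> d) =
      sweedler H H (\<Delta>\<^bsub>H\<^esub> h) (\<lambda>h\<^sub>1 h\<^sub>2. sweedler D D (\<Delta>\<^bsub>D\<^esub> d) (\<lambda>d\<^sub>1 d\<^sub>2.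
        tens D D (h\<^sub>1 \<rhd> d\<^sub>1) (h\<^sub>2 \<rhd> d\<^sub>2)))"
    and comult_ract: "h \<in> carrier H \<Longrightarrow> d \<in> carrier D \<Longrightarrow>
      \<Delta>\<^bsub>D\<^esub> (d \<lhd> h) =
      sweedler D D (\<Delta>\<^bsub>D\<^esub> d) (\<lambda>d\<^sub>1 d\<^sub>2. sweedler H H (\<Delta>\<^bsub>H\<^esub> h) (\<lambda>h\<^sub>1 h\<^sub>2.
        tens D D (d\<^sub>1 \<lhd> h\<^sub>1) (d\<^sub>2 \<lhd> h\<^sub>2)))"
    \<comment> \<open>the second tensor factor reads \<open>(c\<^sub>2\<^sup>(\<^sup>0\<^sup>) \<cdot> d\<^sub>1\<^sup><\<^sup>1\<^sup>>) d\<^sub>2\<close>, with the right action of \<open>d\<^sub>1\<^sup><\<^sup>1\<^sup>> \<in> H\<close>\<close>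
    and comult_mult: "c \<in> carrier D \<Longrightarrow> d \<in> carrier D \<Longrightarrow>
      \<Delta>\<^bsub>D\<^esub> (c \<cdot>\<^bsub>D\<^esub> d) =
      sweedler D D (\<Delta>\<^bsub>D\<^esub> c) (\<lambda>c\<^sub>1 c\<^sub>2. sweedler D D (\<Delta>\<^bsub>D\<^esub> d) (\<lambda>d\<^sub>1 d\<^sub>2.
        sweedler H D (lam c\<^sub>2) (\<lambda>g a. sweedler D H (rho d\<^sub>1) (\<lambda>b h.
          tens D D (c\<^sub>1 \<cdot>\<^bsub>D\<^esub> (g \<rhd> b)) ((a \<lhd> h) \<cdot>\<^bsub>D\<^esub> d\<^sub>2)))))"
    and lam_lact: "h \<in> carrier H \<Longrightarrow> d \<in> carrier D \<Longrightarrow>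
      sweedler H H (\<Delta>\<^bsub>H\<^esub> h) (\<lambda>h\<^sub>1 h\<^sub>2. sweedler H D (lam (h\<^sub>1 \<rhd> d)) (\<lambda>g a.
        tens H D (g \<cdot>\<^bsub>H\<^esub> h\<^sub>2) a)) =
      sweedler H H (\<Delta>\<^bsub>H\<^esub> h) (\<lambda>h\<^sub>1 h\<^sub>2. sweedler H D (lam d) (\<lambda>g a.
        tens H D (h\<^sub>1 \<cdot>\<^bsub>H\<^esub> g) (h\<^sub>2 \<rhd> a)))"
    and rho_lact: "h \<in> carrier H \<Longrightarrow> d \<in> carrier D \<Longrightarrow>
      rho (h \<rhd> d) = sweedler D H (rho d) (\<lambda>a g. tens D H (h \<rhd> a) g)"
    and rho_ract: "h \<in> carrier H \<Longrightarrow> d \<in> carrier D \<Longrightarrow>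
      sweedler H H (\<Delta>\<^bsub>H\<^esub> h) (\<lambda>h\<^sub>1 h\<^sub>2. sweedler D H (rho (d \<lhd> h\<^sub>2)) (\<lambda>a g.
        tens D H a (h\<^sub>1 \<cdot>\<^bsub>H\<^esub> g))) =
      sweedler H H (\<Delta>\<^bsub>H\<^esub> h) (\<lambda>h\<^sub>1 h\<^sub>2. sweedler D H (rho d) (\<lambda>a g.
        tens D H (a \<lhd> h\<^sub>1) (g \<cdot>\<^bsub>H\<^esub> h\<^sub>2)))"
    and lam_ract: "h \<in> carrier H \<Longrightarrow> d \<in> carrier D \<Longrightarrow>
      lam (d \<lhd> h) = sweedler H D (lam d) (\<lambda>g a. tens H D g (a \<lhd> h))"
    and rho_ract_lam_lact: "c \<in> carrier D \<Longrightarrow> d \<in> carrier D \<Longrightarrow>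
      sweedler D H (rho c) (\<lambda>a g. sweedler H D (lam d) (\<lambda>h b.
        tens D D (a \<lhd> h) (g \<rhd> b))) = tens D D c d"

text \<open>The operations are given on simple tensors \<open>d \<natural> h = tens D H d h\<close> by the usual formulas and
  extended linearly; see \<open>biproduct_mult_tens\<close>, \<open>biproduct_comult_tens\<close> and
  \<open>biproduct_counit_tens\<close> below for the formulas on simple tensors.\<close>

definition LR_smash_biproduct ::
  "('k::field, 'h::ab_group_add) alg_coalg \<Rightarrow> ('k, 'd::ab_group_add) alg_coalg
    \<Rightarrow> ('h \<Rightarrow> 'd \<Rightarrow> 'd) \<Rightarrow> ('d \<Rightarrow> 'h \<Rightarrow> 'd)
    \<Rightarrow> ('d \<Rightarrow> ('k, 'd, 'h) tensor) \<Rightarrow> ('d \<Rightarrow> ('k, 'h, 'd) tensor)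
    \<Rightarrow> ('k, ('k, 'd, 'h) tensor) alg_coalg" where
  "LR_smash_biproduct H D lact ract rho lam =
    \<lparr>carrier = carrier (D \<Otimes> H),
     smult = smult (D \<Otimes> H),
     mult = (\<lambda>x y. sweedler D H x (\<lambda>d h. sweedler D H y (\<lambda>d' h'.
       sweedler H H (\<Delta>\<^bsub>H\<^esub> h) (\<lambda>h\<^sub>1 h\<^sub>2. sweedler H H (\<Delta>\<^bsub>H\<^esub> h') (\<lambda>h'\<^sub>1 h'\<^sub>2.
         tens D H (ract d h'\<^sub>2 \<cdot>\<^bsub>D\<^esub> lact h\<^sub>1 d') (h\<^sub>2 \<cdot>\<^bsub>H\<^esub> h'\<^sub>1)))))),
     one = tens D H \<one>\<^bsub>D\<^esub> \<one>\<^bsub>H\<^esub>,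
     comult = (\<lambda>x. sweedler D H x (\<lambda>d h.
       sweedler D D (\<Delta>\<^bsub>D\<^esub> d) (\<lambda>d\<^sub>1 d\<^sub>2. sweedler H H (\<Delta>\<^bsub>H\<^esub> h) (\<lambda>h\<^sub>1 h\<^sub>2.
         sweedler D H (rho d\<^sub>1) (\<lambda>a u. sweedler H D (lam d\<^sub>2) (\<lambda>v b.
           tens (D \<Otimes> H) (D \<Otimes> H)
             (tens D H a (v \<cdot>\<^bsub>H\<^esub> h\<^sub>1)) (tens D H b (h\<^sub>2 \<cdot>\<^bsub>H\<^esub> u)))))))),
     counit = (\<lambda>x. sweedler D H x (\<lambda>d h. \<epsilon>\<^bsub>D\<^esub> d * \<epsilon>\<^bsub>H\<^esub> h))\<rparr>"

subsection \<open>The operations on simple tensors\<close>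

lemma bilinear_onI:
  assumes "\<And>x. x \<in> carrier V \<Longrightarrow> linear_on W X (f x)"
    and "\<And>y. y \<in> carrier W \<Longrightarrow> linear_on V X (\<lambda>x. f x y)"
  shows "bilinear_on V W X f"
  using assms by (auto simp: bilinear_on_def)

lemma linear_on_sum_listI:
  assumes X: "vspace X" and "\<And>p. p \<in> set ps \<Longrightarrow> linear_on V X (\<lambda>x. f x p)"
  shows "linear_on V X (\<lambda>x. sum_list (map (f x) ps))"
  using assms(2)
proof (induction ps)
  case Nil
  show ?case by (simp add: linear_on_def vspace_0[OF X] smult_0[OF X])
next
  case (Cons p ps)
  then have 1: "linear_on V X (\<lambda>x. f x p)" and 2: "linear_on V X (\<lambda>x. sum_list (map (f x) ps))"
    by auto
  show ?case
    unfolding linear_on_def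
  proof (intro conjI ballI allI)
    fix c x assume x: "x \<in> carrier V"
    show "sum_list (map (f x) (p # ps)) \<in> carrier X"
      using linear_onD(1)[OF 1 x] linear_onD(1)[OF 2 x] by (simp add: vspace_add[OF X])
    show "sum_list (map (f (c \<cdot>\<^sub>s\<^bsub>V\<^esub> x)) (p # ps)) = c \<cdot>\<^sub>s\<^bsub>X\<^esub> sum_list (map (f x) (p # ps))"
      using linear_onD(3)[OF 1 x] linear_onD(3)[OF 2 x] by (simp add: smult_add_right[OF X])
  next
    fix x y assume x: "x \<in> carrier V" and y: "y \<in> carrier V"
    show "sum_list (map (f (x + y)) (p # ps)) =
        sum_list (map (f x) (p # ps)) + sum_list (map (f y) (p # ps))"
      using linear_onD(2)[OF 1 x y] linear_onD(2)[OF 2 x y] by (simp add: algebra_simps)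
  qed
qed

lemma linear_on_sweedler_fun:
  assumes V: "vspace V" and W: "vspace W" and X: "vspace X" and t: "t \<in> carrier (V \<Otimes> W)"
    and f: "\<And>a b. a \<in> carrier V \<Longrightarrow> b \<in> carrier W \<Longrightarrow> linear_on U X (\<lambda>x. f x a b)"
  shows "linear_on U X (\<lambda>x. sweedler V W t (\<lambda>a b. f x a b))"
  unfolding sweedler_def
  by (rule linear_on_sum_listI[OF X]) (use tensor_rep(1)[OF V W t] f in auto)

lemma linear_on_sweedler_arg:
  assumes "vspace V" "vspace W" "vspace X" "linear_on U (V \<Otimes> W) t" "bilinear_on V W X f"
  shows "linear_on U X (\<lambda>x. sweedler V W (t x) f)"
  using linear_on_compose[OF assms(4) linear_on_sweedler[OF assms(1-3,5)]] .

lemma linear_on_fun_left: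
  assumes "bilinear_on V W X f" "linear_on U V t" "y \<in> carrier W"
  shows "linear_on U X (\<lambda>x. f (t x) y)"
  using linear_on_compose[OF assms(2) bilinear_onD2[OF assms(1,3)]] .

lemma linear_on_fun_right:
  assumes "bilinear_on V W X f" "linear_on U W t" "x \<in> carrier V"
  shows "linear_on U X (\<lambda>y. f x (t y))"
  using linear_on_compose[OF assms(2) bilinear_onD1[OF assms(1,3)]] .

lemma linear_on_id: "linear_on V V (\<lambda>x. x)"
  by (simp add: linear_on_def)

lemma bilinear_on_scalar_mult:
  "bilinear_on scalars scalars (scalars :: ('k::field, 'k) vspace) (*)"
  by (auto simp: bilinear_on_def linear_on_def scalars_def algebra_simps)

lemma sweedler_closed:
  assumes "vspace V" "vspace W" "vspace X" "t \<in> carrier (V \<Otimes> W)" "bilinear_on V W X f"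
  shows "sweedler V W t f \<in> carrier X"
  using linear_onD(1)[OF linear_on_sweedler[OF assms(1-3,5)] assms(4)] .

context LR_admissible_pair
begin

lemma structure_simps:
  "vspace H" "vspace D" "bilinear_on H H H (mult H)" "bilinear_on D D D (mult D)"
  "linear_on H (H \<Otimes> H) \<Delta>\<^bsub>H\<^esub>" "linear_on D (D \<Otimes> D) \<Delta>\<^bsub>D\<^esub>"
  "linear_on H scalars \<epsilon>\<^bsub>H\<^esub>" "linear_on D scalars \<epsilon>\<^bsub>D\<^esub>"
  using bialgebra_H algebra_D coalgebra_D vspace_D
  by (simp_all add: bialgebra_def algebra_def coalgebra_def)

lemmas linear_intros =
  linear_on_id structure_simps linear_rho linear_lam bilinear_lact bilinear_ract
  vspace_tensor_space vspace_scalars bilinear_on_scalar_mult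
  bilinear_on_tens[OF structure_simps(1,1)] bilinear_on_tens[OF structure_simps(2,2)]
  bilinear_on_tens[OF structure_simps(2,1)] bilinear_on_tens[OF structure_simps(1,2)]
  bilinear_on_tens[OF vspace_tensor_space vspace_tensor_space]
  linear_on_compose[OF _ structure_simps(5)] linear_on_compose[OF _ structure_simps(6)]
  linear_on_compose[OF _ structure_simps(7)] linear_on_compose[OF _ structure_simps(8)]
  linear_on_compose[OF _ linear_rho] linear_on_compose[OF _ linear_lam]
  linear_onD(1)[OF structure_simps(5)] linear_onD(1)[OF structure_simps(6)]
  linear_onD(1)[OF structure_simps(7)] linear_onD(1)[OF structure_simps(8)]
  linear_onD(1)[OF linear_rho] linear_onD(1)[OF linear_lam]
  bilinear_onI

lemmas bilinear_consts =
  structure_simps(3,4) bilinear_lact bilinear_ract bilinear_on_scalar_mult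
  bilinear_on_tens[OF structure_simps(1,1)] bilinear_on_tens[OF structure_simps(2,2)]
  bilinear_on_tens[OF structure_simps(2,1)] bilinear_on_tens[OF structure_simps(1,2)]
  bilinear_on_tens[OF vspace_tensor_space vspace_tensor_space]

lemmas linear_rules =
  linear_intros bilinear_consts[THEN bilinear_onD]
  bilinear_consts[THEN linear_on_fun_left] bilinear_consts[THEN linear_on_fun_right]
  linear_on_sweedler_arg[OF structure_simps(1,1)] linear_on_sweedler_arg[OF structure_simps(2,2)]
  linear_on_sweedler_arg[OF structure_simps(1,2)] linear_on_sweedler_arg[OF structure_simps(2,1)]
  linear_on_sweedler_fun[OF structure_simps(1,1)] linear_on_sweedler_fun[OF structure_simps(2,2)]
  linear_on_sweedler_fun[OF structure_simps(1,2)] linear_on_sweedler_fun[OF structure_simps(2,1)]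
  sweedler_closed[OF structure_simps(1,1)] sweedler_closed[OF structure_simps(2,2)]
  sweedler_closed[OF structure_simps(1,2)] sweedler_closed[OF structure_simps(2,1)]

abbreviation "B \<equiv> LR_smash_biproduct H D lact ract rho lam"

lemma biproduct_mult_tens:
  assumes "d \<in> carrier D" "h \<in> carrier H" "d' \<in> carrier D" "h' \<in> carrier H"
  shows "tens D H d h \<cdot>\<^bsub>B\<^esub> tens D H d' h' =
    sweedler H H (\<Delta>\<^bsub>H\<^esub> h) (\<lambda>h\<^sub>1 h\<^sub>2. sweedler H H (\<Delta>\<^bsub>H\<^esub> h') (\<lambda>h'\<^sub>1 h'\<^sub>2.
      tens D H ((d \<lhd> h'\<^sub>2) \<cdot>\<^bsub>D\<^esub> (h\<^sub>1 \<rhd> d')) (h\<^sub>2 \<cdot>\<^bsub>H\<^esub> h'\<^sub>1)))"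
proof -
  have "tens D H d h \<cdot>\<^bsub>B\<^esub> tens D H d' h' =
    sweedler D H (tens D H d' h') (\<lambda>d' h'.
      sweedler H H (\<Delta>\<^bsub>H\<^esub> h) (\<lambda>h\<^sub>1 h\<^sub>2. sweedler H H (\<Delta>\<^bsub>H\<^esub> h') (\<lambda>h'\<^sub>1 h'\<^sub>2.
        tens D H ((d \<lhd> h'\<^sub>2) \<cdot>\<^bsub>D\<^esub> (h\<^sub>1 \<rhd> d')) (h\<^sub>2 \<cdot>\<^bsub>H\<^esub> h'\<^sub>1))))"
    unfolding LR_smash_biproduct_def alg_coalg.simps
    by (rule sweedler_tens[where X = "D \<Otimes> H"])
      (insert assms, (assumption | rule linear_rules)+)
  also have "\<dots> = sweedler H H (\<Delta>\<^bsub>H\<^esub> h) (\<lambda>h\<^sub>1 h\<^sub>2. sweedler H H (\<Delta>\<^bsub>H\<^esub> h') (\<lambda>h'\<^sub>1 h'\<^sub>2.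
        tens D H ((d \<lhd> h'\<^sub>2) \<cdot>\<^bsub>D\<^esub> (h\<^sub>1 \<rhd> d')) (h\<^sub>2 \<cdot>\<^bsub>H\<^esub> h'\<^sub>1)))"
    by (rule sweedler_tens[where X = "D \<Otimes> H"])
      (insert assms, (assumption | rule linear_rules)+)
  finally show ?thesis .
qed

lemma biproduct_comult_tens:
  assumes "d \<in> carrier D" "h \<in> carrier H"
  shows "\<Delta>\<^bsub>B\<^esub> (tens D H d h) =
    sweedler D D (\<Delta>\<^bsub>D\<^esub> d) (\<lambda>d\<^sub>1 d\<^sub>2. sweedler H H (\<Delta>\<^bsub>H\<^esub> h) (\<lambda>h\<^sub>1 h\<^sub>2.
      sweedler D H (rho d\<^sub>1) (\<lambda>a u. sweedler H D (lam d\<^sub>2) (\<lambda>v b.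
        tens (D \<Otimes> H) (D \<Otimes> H)
          (tens D H a (v \<cdot>\<^bsub>H\<^esub> h\<^sub>1)) (tens D H b (h\<^sub>2 \<cdot>\<^bsub>H\<^esub> u))))))"
  unfolding LR_smash_biproduct_def alg_coalg.simps
  by (rule sweedler_tens[where X = "(D \<Otimes> H) \<Otimes> (D \<Otimes> H)"])
    (insert assms, (assumption | rule linear_rules)+)

lemma biproduct_counit_tens:
  assumes "d \<in> carrier D" "h \<in> carrier H"
  shows "\<epsilon>\<^bsub>B\<^esub> (tens D H d h) = \<epsilon>\<^bsub>D\<^esub> d * \<epsilon>\<^bsub>H\<^esub> h"
  unfolding LR_smash_biproduct_def alg_coalg.simps
  by (rule sweedler_tens[where X = scalars])
    (insert assms, (assumption | rule linear_rules)+)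

end

end

theory Submission
  imports Defs
begin

text \<open>On simple tensors each bialgebra axiom of \<open>D \<natural> H\<close> is an identity of multilinear Sweedler sums.
  Both sides are expanded by the compatibility conditions and then brought to a common form by
  coassociativity. Sweedler sums are literal finite sums, so independent ones commute without any
  linearity; linearity is needed only to apply the axioms inside them.

  For \<open>\<Delta>(xy) = \<Delta>(x)\<Delta>(y)\<close> with \<open>x = d \<natural> h\<close> and \<open>y = e \<natural> k\<close>, the expansion of the left-hand side contains
  \<open>\<lambda>(h\<^sub>2 \<cdot> e\<^sub>2)\<close> and \<open>\<rho>(d\<^sub>1 \<cdot> k\<^sub>3)\<close>, next to the factors \<open>h\<^sub>3\<close> and \<open>k\<^sub>2\<close> with which \<open>lam_lact\<close> and
  \<open>rho_ract\<close> resolve them. The right-hand side has in addition the pair of actions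
  \<open>c\<^sup><\<^sup>0\<^sup>> \<cdot> b\<^sup>(\<^sup>-\<^sup>1\<^sup>) \<otimes> c\<^sup><\<^sup>1\<^sup>> \<cdot> b\<^sup>(\<^sup>0\<^sup>)\<close> for \<open>c = d\<^sub>1\<^sup><\<^sup>0\<^sup>>\<close> and \<open>b = e\<^sub>2\<^sup>(\<^sup>0\<^sup>)\<close>, which the last condition of
  an admissible pair removes.\<close>

section \<open>Computing with Sweedler sums\<close>

lemma sum_list_swap:
  fixes f :: "'a \<Rightarrow> 'b \<Rightarrow> 'c::ab_group_add"
  shows "(\<Sum>x\<leftarrow>xs. \<Sum>y\<leftarrow>ys. f x y) = (\<Sum>y\<leftarrow>ys. \<Sum>x\<leftarrow>xs. f x y)"
  by (induction xs) (simp_all add: sum_list_addf)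

text \<open>Both sides are double sums over the chosen representations of \<open>t\<close> and
  \<open>s\<close>. Neither tensor may depend on the summation variables of the other.\<close>

lemma sweedler_swap:
  "sweedler V W t (\<lambda>a b. sweedler V' W' s (\<lambda>c d. f a b c d)) =
   sweedler V' W' s (\<lambda>c d. sweedler V W t (\<lambda>a b. f a b c d))"
  unfolding sweedler_def case_prod_unfold by (rule sum_list_swap)

lemma sweedler_cong:
  assumes "vspace V" "vspace W" "t \<in> carrier (V \<Otimes> W)"
    and "\<And>a b. a \<in> carrier V \<Longrightarrow> b \<in> carrier W \<Longrightarrow> f a b = g a b"
  shows "sweedler V W t f = sweedler V W t g"
  unfolding sweedler_def
  by (intro arg_cong[where f = sum_list] map_cong)
    (use tensor_rep(1)[OF assms(1-3)] assms(4) in auto)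

text \<open>A linear map commutes with finite sums. The summand \<open>g\<close> is kept apart from
  \<open>\<phi> (f a b)\<close>, so that the last premise can rewrite the summand further when the
  rule is used in resolution.\<close>

lemma linear_on_sweedler_apply:
  assumes "linear_on Y X \<phi>" and "vspace Y" "vspace V" "vspace W" "t \<in> carrier (V \<Otimes> W)"
    and "\<And>a b. a \<in> carrier V \<Longrightarrow> b \<in> carrier W \<Longrightarrow> f a b \<in> carrier Y"
    and "\<And>a b. a \<in> carrier V \<Longrightarrow> b \<in> carrier W \<Longrightarrow> \<phi> (f a b) = g a b"
  shows "\<phi> (sweedler V W t f) = sweedler V W t g"
proof -
  have "\<phi> (sweedler V W t f) = sweedler V W t (\<lambda>a b. \<phi> (f a b))"
    unfolding sweedler_def case_prod_unfold
    by (rule linear_on_sum_list[OF assms(2,1)])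
      (use tensor_rep(1)[OF assms(3-5)] assms(6) in auto)
  also have "\<dots> = sweedler V W t g"
    by (rule sweedler_cong[OF assms(3-5,7)])
  finally show ?thesis .
qed

lemma sweedler_in_carrier:
  assumes "vspace V" "vspace W" "vspace X" "t \<in> carrier (V \<Otimes> W)"
    and "\<And>a b. a \<in> carrier V \<Longrightarrow> b \<in> carrier W \<Longrightarrow> f a b \<in> carrier X"
  shows "sweedler V W t f \<in> carrier X"
  unfolding sweedler_def case_prod_unfold
  by (rule sum_list_in_carrier[OF assms(3)])
    (use tensor_rep(1)[OF assms(1,2,4)] assms(5) in auto)

lemma tens_in_carrier:
  assumes "vspace V" "vspace W" "x \<in> carrier V" "y \<in> carrier W"
  shows "tens V W x y \<in> carrier (V \<Otimes> W)"
  using bilinear_onD[OF bilinear_on_tens[OF assms(1,2)] assms(3,4)] .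

text \<open>An equation in a shape that makes its two rules a logic program: resolution searches \<open>e\<close> for the
  summation over \<open>t\<close> and moves it to the front.\<close>

definition pulls_out :: "'x::ab_group_add \<Rightarrow> ('k::field, 'v::ab_group_add, 'm) vspace_scheme
    \<Rightarrow> ('k, 'w::ab_group_add, 'n) vspace_scheme \<Rightarrow> ('k, 'v, 'w) tensor \<Rightarrow> ('v \<Rightarrow> 'w \<Rightarrow> 'x) \<Rightarrow> bool" where
  "pulls_out e V W t f \<longleftrightarrow> e = sweedler V W t f"

lemma pulls_out_here: "pulls_out (sweedler V W t f) V W t f"
  by (simp add: pulls_out_def)

text \<open>The tensor \<open>t\<close> stands outside the scope of \<open>a\<close> and
  \<open>b\<close>, so only a sum independent of the one passed over is lifted.\<close>

lemma pulls_out_under: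
  assumes "\<And>a b. pulls_out (e a b) V W t (\<lambda>c d. f a b c d)"
  shows "pulls_out (sweedler V' W' s (\<lambda>a b. e a b)) V W t
    (\<lambda>c d. sweedler V' W' s (\<lambda>a b. f a b c d))"
  using assms by (simp add: pulls_out_def sweedler_swap[of V W])

lemmas pull_rules = pulls_out_here pulls_out_under

text \<open>Congruence up to the order of summation: the outermost sum on the left is located at any
  depth on the right, and the summands remain to be compared.\<close>

lemma sweedler_match:
  assumes "pulls_out r V W t g" "vspace V" "vspace W" "t \<in> carrier (V \<Otimes> W)"
    and "\<And>a b. a \<in> carrier V \<Longrightarrow> b \<in> carrier W \<Longrightarrow> f a b = g a b"
  shows "sweedler V W t f = r"
  using sweedler_cong[OF assms(2-5)] assms(1) by (simp add: pulls_out_def)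

lemma sweedler_eqD:
  assumes "s = t" "sweedler V W s f = r"
  shows "sweedler V W t f = r"
  using assms by simp

section \<open>Trilinear maps and threefold tensor products\<close>

definition trilinear_on where
  "trilinear_on U V W X f \<longleftrightarrow>
     (\<forall>y\<in>carrier V. \<forall>z\<in>carrier W. linear_on U X (\<lambda>x. f x y z)) \<and>
     (\<forall>x\<in>carrier U. \<forall>z\<in>carrier W. linear_on V X (\<lambda>y. f x y z)) \<and>
     (\<forall>x\<in>carrier U. \<forall>y\<in>carrier V. linear_on W X (\<lambda>z. f x y z))"

lemma trilinear_onI:
  assumes "\<And>y z. y \<in> carrier V \<Longrightarrow> z \<in> carrier W \<Longrightarrow> linear_on U X (\<lambda>x. f x y z)"
    and "\<And>x z. x \<in> carrier U \<Longrightarrow> z \<in> carrier W \<Longrightarrow> linear_on V X (\<lambda>y. f x y z)"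
    and "\<And>x y. x \<in> carrier U \<Longrightarrow> y \<in> carrier V \<Longrightarrow> linear_on W X (\<lambda>z. f x y z)"
  shows "trilinear_on U V W X f"
  using assms by (auto simp: trilinear_on_def)

lemma trilinear_onD:
  assumes "trilinear_on U V W X f"
  shows "x \<in> carrier U \<Longrightarrow> bilinear_on V W X (f x)"
    and "y \<in> carrier V \<Longrightarrow> z \<in> carrier W \<Longrightarrow> linear_on U X (\<lambda>x. f x y z)"
    and "y \<in> carrier V \<Longrightarrow> bilinear_on U W X (\<lambda>x. f x y)"
    and "z \<in> carrier W \<Longrightarrow> bilinear_on U V X (\<lambda>x y. f x y z)"
  using assms by (auto simp: trilinear_on_def bilinear_on_def)

text \<open>The linear map on the threefold tensor product that a trilinear \<open>f\<close>
  induces.\<close>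

definition lift3 where
  "lift3 U V W f t = sweedler U (V \<Otimes> W) t (\<lambda>x s. sweedler V W s (f x))"

lemma
  assumes "vspace U" "vspace V" "vspace W" "vspace X" and f: "trilinear_on U V W X f"
  shows linear_on_lift3: "linear_on (U \<Otimes> (V \<Otimes> W)) X (lift3 U V W f)"
    and lift3_tens: "x \<in> carrier U \<Longrightarrow> y \<in> carrier V \<Longrightarrow> z \<in> carrier W \<Longrightarrow>
      lift3 U V W f (tens U (V \<Otimes> W) x (tens V W y z)) = f x y z"
proof -
  have *: "bilinear_on U (V \<Otimes> W) X (\<lambda>x s. sweedler V W s (f x))"
    by (rule bilinear_onI)
      (auto intro: linear_on_sweedler linear_on_sweedler_fun assms trilinear_onD[OF f])
  show "linear_on (U \<Otimes> (V \<Otimes> W)) X (lift3 U V W f)"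
    unfolding lift3_def by (rule linear_on_sweedler) (auto intro: assms *)
  show "x \<in> carrier U \<Longrightarrow> y \<in> carrier V \<Longrightarrow> z \<in> carrier W \<Longrightarrow>
      lift3 U V W f (tens U (V \<Otimes> W) x (tens V W y z)) = f x y z"
    unfolding lift3_def
    by (subst sweedler_tens[OF _ _ _ *])
      (auto intro: assms tens_in_carrier sweedler_tens trilinear_onD[OF f])
qed

text \<open>The special case \<open>\<phi> = lift3 U V W f\<close> is stated separately, so that
  unification need not guess \<open>\<phi>\<close>.\<close>

lemma lift3_sweedler:
  assumes "vspace U" "vspace V" "vspace W" "vspace X" "trilinear_on U V W X f"
    and "vspace V'" "vspace W'" "s \<in> carrier (V' \<Otimes> W')"
    and "\<And>a b. a \<in> carrier V' \<Longrightarrow> b \<in> carrier W' \<Longrightarrow> g a b \<in> carrier (U \<Otimes> (V \<Otimes> W))"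
    and "\<And>a b. a \<in> carrier V' \<Longrightarrow> b \<in> carrier W' \<Longrightarrow> lift3 U V W f (g a b) = g' a b"
  shows "lift3 U V W f (sweedler V' W' s g) = sweedler V' W' s g'"
  by (rule linear_on_sweedler_apply[where \<phi> = "lift3 U V W f",
      OF linear_on_lift3[OF assms(1-5)] vspace_tensor_space assms(6-10)])

text \<open>Turns an axiom \<open>s = t\<close> between threefold tensors into an identity for an
  arbitrary trilinear \<open>f\<close>: the two sides are evaluated separately to the Sweedler sums
  \<open>a\<close> and \<open>b\<close>.\<close>

lemma lift3_transfer:
  assumes "s = t" "lift3 U V W f s = a" "lift3 U V W f t = b"
  shows "a = b"
  using assms by simp

section \<open>Multilinear maps are determined by simple tensors\<close>

lemma bilinear_on_tensor_eqI:
  assumes "vspace U" "vspace V" "vspace U'" "vspace V'"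
    and "bilinear_on (U \<Otimes> V) (U' \<Otimes> V') X f" "bilinear_on (U \<Otimes> V) (U' \<Otimes> V') X g"
    and "\<And>a b c d. a \<in> carrier U \<Longrightarrow> b \<in> carrier V \<Longrightarrow> c \<in> carrier U' \<Longrightarrow> d \<in> carrier V' \<Longrightarrow>
      f (tens U V a b) (tens U' V' c d) = g (tens U V a b) (tens U' V' c d)"
    and "s \<in> carrier (U \<Otimes> V)" "t \<in> carrier (U' \<Otimes> V')"
  shows "f s t = g s t"
proof (rule linear_on_tensor_eqI[OF assms(1,2) _ _ _ assms(8)])
  fix a b assume ab: "a \<in> carrier U" "b \<in> carrier V"
  note s = tens_in_carrier[OF assms(1,2) ab]
  show "f (tens U V a b) t = g (tens U V a b) t"
    by (rule linear_on_tensor_eqI[OF assms(3,4) bilinear_onD1[OF assms(5) s]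
          bilinear_onD1[OF assms(6) s] assms(7)[OF ab] assms(9)])
qed (fact bilinear_onD2[OF assms(5,9)] bilinear_onD2[OF assms(6,9)])+

lemma trilinear_on_tensor_eqI:
  assumes "vspace U" "vspace V" "vspace U'" "vspace V'" "vspace U''" "vspace V''"
    and f: "trilinear_on (U \<Otimes> V) (U' \<Otimes> V') (U'' \<Otimes> V'') X f"
    and g: "trilinear_on (U \<Otimes> V) (U' \<Otimes> V') (U'' \<Otimes> V'') X g"
    and eq: "\<And>a b c d p q. a \<in> carrier U \<Longrightarrow> b \<in> carrier V \<Longrightarrow> c \<in> carrier U' \<Longrightarrow> d \<in> carrier V' \<Longrightarrow>
      p \<in> carrier U'' \<Longrightarrow> q \<in> carrier V'' \<Longrightarrow>
      f (tens U V a b) (tens U' V' c d) (tens U'' V'' p q) =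
      g (tens U V a b) (tens U' V' c d) (tens U'' V'' p q)"
    and "s \<in> carrier (U \<Otimes> V)" "t \<in> carrier (U' \<Otimes> V')" "u \<in> carrier (U'' \<Otimes> V'')"
  shows "f s t u = g s t u"
proof (rule linear_on_tensor_eqI[OF assms(1,2) _ _ _ assms(10)])
  fix a b assume ab: "a \<in> carrier U" "b \<in> carrier V"
  note s = tens_in_carrier[OF assms(1,2) ab]
  show "f (tens U V a b) t u = g (tens U V a b) t u"
    by (rule bilinear_on_tensor_eqI[OF assms(3-6) trilinear_onD(1)[OF f s]
          trilinear_onD(1)[OF g s] eq[OF ab] assms(11,12)])
qed (fact trilinear_onD(2)[OF f assms(11,12)] trilinear_onD(2)[OF g assms(11,12)])+

section \<open>Scalar multiples and evaluation of Sweedler sums\<close>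

lemma linear_on_smult_right:
  assumes "vspace X" "linear_on U X f"
  shows "linear_on U X (\<lambda>x. c \<cdot>\<^sub>s\<^bsub>X\<^esub> f x)"
  using assms(2) by (auto simp: linear_on_def vspace_smult[OF assms(1)] smult_add_right[OF assms(1)]
      smult_smult[OF assms(1)] mult.commute)

lemma linear_on_smult_left:
  assumes "vspace X" "linear_on U scalars g" "y \<in> carrier X"
  shows "linear_on U X (\<lambda>x. g x \<cdot>\<^sub>s\<^bsub>X\<^esub> y)"
  using assms(2,3) by (auto simp: linear_on_def scalars_def vspace_smult[OF assms(1)]
      smult_add_left[OF assms(1)] smult_smult[OF assms(1)])

text \<open>Transports a counit identity through a linear map \<open>f\<close>. In its uses,
  \<open>c\<close> is a counit of one tensor leg and \<open>g\<close> selects the surviving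
  leg.\<close>

lemma sweedler_smult_linear:
  assumes "linear_on V X f" "vspace V" "vspace W" "vspace U" "t \<in> carrier (W \<Otimes> U)"
    and "\<And>a b. a \<in> carrier W \<Longrightarrow> b \<in> carrier U \<Longrightarrow> g a b \<in> carrier V"
    and "sweedler W U t (\<lambda>a b. c a b \<cdot>\<^sub>s\<^bsub>V\<^esub> g a b) = y"
  shows "sweedler W U t (\<lambda>a b. c a b \<cdot>\<^sub>s\<^bsub>X\<^esub> f (g a b)) = f y"
  unfolding assms(7)[symmetric]
  by (rule sym, rule linear_on_sweedler_apply[OF assms(1-5)])
    (auto simp: assms(6) linear_onD(3)[OF assms(1)] vspace_smult[OF assms(2)])

text \<open>In these and later rules the target space \<open>X\<close> occurs only in the linearity premises, where
  resolution cannot determine it; it has to be instantiated before use.\<close>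

lemma sweedler_of_sweedler:
  assumes "vspace V" "vspace W" "vspace X" "vspace V'" "vspace W'"
    and "bilinear_on V W X f" "s \<in> carrier (V' \<Otimes> W')"
    and "\<And>a b. a \<in> carrier V' \<Longrightarrow> b \<in> carrier W' \<Longrightarrow> g a b \<in> carrier (V \<Otimes> W)"
    and "sweedler V' W' s (\<lambda>a b. sweedler V W (g a b) f) = r"
  shows "sweedler V W (sweedler V' W' s g) f = r"
  using linear_on_sweedler_apply[OF linear_on_sweedler[OF assms(1-3,6)] vspace_tensor_space
      assms(4,5,7,8) refl] assms(9) by simp

lemma sweedler_of_tens:
  assumes "vspace V" "vspace W" "vspace X" "bilinear_on V W X f" "x \<in> carrier V" "y \<in> carrier W"
    and "f x y = r"
  shows "sweedler V W (tens V W x y) f = r"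
  using sweedler_tens[OF assms(1-6)] assms(7) by simp

section \<open>Sweedler calculus in an admissible pair\<close>

context LR_admissible_pair
begin

lemmas calc_closed =
  structure_simps(1,2) vspace_tensor_space vspace_scalars
  linear_onD(1)[OF structure_simps(5)] linear_onD(1)[OF structure_simps(6)]
  linear_onD(1)[OF linear_rho] linear_onD(1)[OF linear_lam]
  structure_simps(3,4)[THEN bilinear_onD]
  bilinear_lact[THEN bilinear_onD] bilinear_ract[THEN bilinear_onD]
  tens_in_carrier sweedler_in_carrier
  linear_onD(1)[OF structure_simps(7)] linear_onD(1)[OF structure_simps(8)]

text \<open>Linearity of a Sweedler expression in a variable that occurs once follows by recursion
  on the expression. Bilinear and trilinear goals split into one goal for each variable.\<close>

lemmas calc_linear =
  linear_on_id linear_on_compose[OF _ structure_simps(5)] linear_on_compose[OF _ structure_simps(6)]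
  linear_on_compose[OF _ linear_rho] linear_on_compose[OF _ linear_lam]
  linear_on_compose[OF _ structure_simps(7)] linear_on_compose[OF _ structure_simps(8)]
  structure_simps(3,4)[THEN linear_on_fun_left] structure_simps(3,4)[THEN linear_on_fun_right]
  bilinear_lact[THEN linear_on_fun_left] bilinear_lact[THEN linear_on_fun_right]
  bilinear_ract[THEN linear_on_fun_left] bilinear_ract[THEN linear_on_fun_right]
  bilinear_on_tens[THEN linear_on_fun_left] bilinear_on_tens[THEN linear_on_fun_right]
  linear_on_sweedler_arg linear_on_sweedler_fun
  bilinear_onI trilinear_onI

lemmas calc_rules = calc_linear calc_closed pull_rules

abbreviation SH :: "'h \<Rightarrow> ('h \<Rightarrow> 'h \<Rightarrow> 'x::ab_group_add) \<Rightarrow> 'x" where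
  "SH h \<equiv> sweedler H H (\<Delta>\<^bsub>H\<^esub> h)"
abbreviation SD :: "'d \<Rightarrow> ('d \<Rightarrow> 'd \<Rightarrow> 'x::ab_group_add) \<Rightarrow> 'x" where
  "SD d \<equiv> sweedler D D (\<Delta>\<^bsub>D\<^esub> d)"
abbreviation SR :: "'d \<Rightarrow> ('d \<Rightarrow> 'h \<Rightarrow> 'x::ab_group_add) \<Rightarrow> 'x" where
  "SR d \<equiv> sweedler D H (rho d)"
abbreviation SL :: "'d \<Rightarrow> ('h \<Rightarrow> 'd \<Rightarrow> 'x::ab_group_add) \<Rightarrow> 'x" where
  "SL d \<equiv> sweedler H D (lam d)"

section \<open>Structure maps of products and of actions under a sum\<close>

lemma
  shows comult_H_one: "\<Delta>\<^bsub>H\<^esub> \<one>\<^bsub>H\<^esub> = tens H H \<one>\<^bsub>H\<^esub> \<one>\<^bsub>H\<^esub>"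
    and comult_H_mult: "g \<in> carrier H \<Longrightarrow> h \<in> carrier H \<Longrightarrow>
      \<Delta>\<^bsub>H\<^esub> (g \<cdot>\<^bsub>H\<^esub> h) = SH g (\<lambda>g\<^sub>1 g\<^sub>2. SH h (\<lambda>h\<^sub>1 h\<^sub>2. tens H H (g\<^sub>1 \<cdot>\<^bsub>H\<^esub> h\<^sub>1) (g\<^sub>2 \<cdot>\<^bsub>H\<^esub> h\<^sub>2)))"
  using bialgebra_H by (auto simp: bialgebra_def)

text \<open>Multiplicativity of the comultiplication, evaluated under a bilinear \<open>f\<close>.
  Here and in the following rules the right-hand side is an arbitrary \<open>r\<close>: resolution
  replaces the sum by its expansion and leaves the rest of the calculation as the next goal.\<close>

lemma SH_mult:
  assumes "vspace X" "g \<in> carrier H" "h \<in> carrier H" "bilinear_on H H X f"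
    and "SH g (\<lambda>g\<^sub>1 g\<^sub>2. SH h (\<lambda>h\<^sub>1 h\<^sub>2. f (g\<^sub>1 \<cdot>\<^bsub>H\<^esub> h\<^sub>1) (g\<^sub>2 \<cdot>\<^bsub>H\<^esub> h\<^sub>2))) = r"
  shows "SH (g \<cdot>\<^bsub>H\<^esub> h) f = r"
  unfolding assms(5)[symmetric] comult_H_mult[OF assms(2,3)]
  by (insert assms(1-4),
    (assumption | rule sweedler_of_sweedler[where X = X] sweedler_of_tens[where X = X]
        sweedler_match calc_rules refl)+)

lemma SD_lact:
  assumes "vspace X" "h \<in> carrier H" "d \<in> carrier D" "bilinear_on D D X f"
    and "SH h (\<lambda>h\<^sub>1 h\<^sub>2. SD d (\<lambda>d\<^sub>1 d\<^sub>2. f (h\<^sub>1 \<rhd> d\<^sub>1) (h\<^sub>2 \<rhd> d\<^sub>2))) = r"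
  shows "SD (h \<rhd> d) f = r"
  unfolding assms(5)[symmetric] comult_lact[OF assms(2,3)]
  by (insert assms(1-4),
    (assumption | rule sweedler_of_sweedler[where X = X] sweedler_of_tens[where X = X]
        sweedler_match calc_rules refl)+)

lemma SD_ract:
  assumes "vspace X" "h \<in> carrier H" "d \<in> carrier D" "bilinear_on D D X f"
    and "SD d (\<lambda>d\<^sub>1 d\<^sub>2. SH h (\<lambda>h\<^sub>1 h\<^sub>2. f (d\<^sub>1 \<lhd> h\<^sub>1) (d\<^sub>2 \<lhd> h\<^sub>2))) = r"
  shows "SD (d \<lhd> h) f = r"
  unfolding assms(5)[symmetric] comult_ract[OF assms(2,3)]
  by (insert assms(1-4),
    (assumption | rule sweedler_of_sweedler[where X = X] sweedler_of_tens[where X = X]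
        sweedler_match calc_rules refl)+)

lemma SD_mult:
  assumes "vspace X" "c \<in> carrier D" "d \<in> carrier D" "bilinear_on D D X f"
    and "SD c (\<lambda>c\<^sub>1 c\<^sub>2. SD d (\<lambda>d\<^sub>1 d\<^sub>2. SL c\<^sub>2 (\<lambda>g a. SR d\<^sub>1 (\<lambda>b h.
      f (c\<^sub>1 \<cdot>\<^bsub>D\<^esub> (g \<rhd> b)) ((a \<lhd> h) \<cdot>\<^bsub>D\<^esub> d\<^sub>2))))) = r"
  shows "SD (c \<cdot>\<^bsub>D\<^esub> d) f = r"
  unfolding assms(5)[symmetric] comult_mult[OF assms(2,3)]
  by (insert assms(1-4),
    (assumption | rule sweedler_of_sweedler[where X = X] sweedler_of_tens[where X = X]
        sweedler_match calc_rules refl)+)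

lemma SR_mult:
  assumes "vspace X" "c \<in> carrier D" "d \<in> carrier D" "bilinear_on D H X f"
    and "SR c (\<lambda>a g. SR d (\<lambda>b h. f (a \<cdot>\<^bsub>D\<^esub> b) (g \<cdot>\<^bsub>H\<^esub> h))) = r"
  shows "SR (c \<cdot>\<^bsub>D\<^esub> d) f = r"
  unfolding assms(5)[symmetric] rho_mult[OF assms(2,3)]
  by (insert assms(1-4),
    (assumption | rule sweedler_of_sweedler[where X = X] sweedler_of_tens[where X = X]
        sweedler_match calc_rules refl)+)

lemma SL_mult:
  assumes "vspace X" "c \<in> carrier D" "d \<in> carrier D" "bilinear_on H D X f"
    and "SL c (\<lambda>g a. SL d (\<lambda>h b. f (g \<cdot>\<^bsub>H\<^esub> h) (a \<cdot>\<^bsub>D\<^esub> b))) = r"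
  shows "SL (c \<cdot>\<^bsub>D\<^esub> d) f = r"
  unfolding assms(5)[symmetric] lam_mult[OF assms(2,3)]
  by (insert assms(1-4),
    (assumption | rule sweedler_of_sweedler[where X = X] sweedler_of_tens[where X = X]
        sweedler_match calc_rules refl)+)

lemma SR_lact:
  assumes "vspace X" "h \<in> carrier H" "d \<in> carrier D" "bilinear_on D H X f"
    and "SR d (\<lambda>a g. f (h \<rhd> a) g) = r"
  shows "SR (h \<rhd> d) f = r"
  unfolding assms(5)[symmetric] rho_lact[OF assms(2,3)]
  by (insert assms(1-4),
    (assumption | rule sweedler_of_sweedler[where X = X] sweedler_of_tens[where X = X]
        sweedler_match calc_rules refl)+)

lemma SL_ract:
  assumes "vspace X" "h \<in> carrier H" "d \<in> carrier D" "bilinear_on H D X f"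
    and "SL d (\<lambda>g a. f g (a \<lhd> h)) = r"
  shows "SL (d \<lhd> h) f = r"
  unfolding assms(5)[symmetric] lam_ract[OF assms(2,3)]
  by (insert assms(1-4),
    (assumption | rule sweedler_of_sweedler[where X = X] sweedler_of_tens[where X = X]
        sweedler_match calc_rules refl)+)

text \<open>The summand on either side of \<open>lam_lact\<close> has the form \<open>f (g h\<^sub>2) a\<close>, from which unification cannot
  recover \<open>f\<close>. Summing over an auxiliary tensor, expanded in one of two ways, avoids this; the same
  holds for \<open>rho_ract\<close>, and for \<open>rho_ract_lam_lact\<close> with a pure tensor.\<close>

definition lact_lam :: "'h \<Rightarrow> 'd \<Rightarrow> ('k, 'h, 'd) tensor" where
  "lact_lam h d = SH h (\<lambda>h\<^sub>1 h\<^sub>2. SL (h\<^sub>1 \<rhd> d) (\<lambda>g a. tens H D (g \<cdot>\<^bsub>H\<^esub> h\<^sub>2) a))"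

definition ract_rho :: "'d \<Rightarrow> 'h \<Rightarrow> ('k, 'd, 'h) tensor" where
  "ract_rho d h = SH h (\<lambda>h\<^sub>1 h\<^sub>2. SR (d \<lhd> h\<^sub>2) (\<lambda>a g. tens D H a (h\<^sub>1 \<cdot>\<^bsub>H\<^esub> g)))"

lemma lact_lam_left:
  assumes "vspace X" "h \<in> carrier H" "d \<in> carrier D" "bilinear_on H D X f"
    and "SH h (\<lambda>h\<^sub>1 h\<^sub>2. SL (h\<^sub>1 \<rhd> d) (\<lambda>g a. f (g \<cdot>\<^bsub>H\<^esub> h\<^sub>2) a)) = r"
  shows "sweedler H D (lact_lam h d) f = r"
  unfolding assms(5)[symmetric] lact_lam_def
  by (insert assms(1-4),
    (assumption | rule sweedler_of_sweedler[where X = X] sweedler_of_tens[where X = X]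
        sweedler_match calc_rules refl)+)

lemma lact_lam_right:
  assumes "vspace X" "h \<in> carrier H" "d \<in> carrier D" "bilinear_on H D X f"
    and "SH h (\<lambda>h\<^sub>1 h\<^sub>2. SL d (\<lambda>g a. f (h\<^sub>1 \<cdot>\<^bsub>H\<^esub> g) (h\<^sub>2 \<rhd> a))) = r"
  shows "sweedler H D (lact_lam h d) f = r"
  unfolding assms(5)[symmetric] lact_lam_def lam_lact[OF assms(2,3)]
  by (insert assms(1-4),
    (assumption | rule sweedler_of_sweedler[where X = X] sweedler_of_tens[where X = X]
        sweedler_match calc_rules refl)+)

lemma ract_rho_left:
  assumes "vspace X" "h \<in> carrier H" "d \<in> carrier D" "bilinear_on D H X f"
    and "SH h (\<lambda>h\<^sub>1 h\<^sub>2. SR (d \<lhd> h\<^sub>2) (\<lambda>a g. f a (h\<^sub>1 \<cdot>\<^bsub>H\<^esub> g))) = r"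
  shows "sweedler D H (ract_rho d h) f = r"
  unfolding assms(5)[symmetric] ract_rho_def
  by (insert assms(1-4),
    (assumption | rule sweedler_of_sweedler[where X = X] sweedler_of_tens[where X = X]
        sweedler_match calc_rules refl)+)

lemma ract_rho_right:
  assumes "vspace X" "h \<in> carrier H" "d \<in> carrier D" "bilinear_on D H X f"
    and "SH h (\<lambda>h\<^sub>1 h\<^sub>2. SR d (\<lambda>a g. f (a \<lhd> h\<^sub>1) (g \<cdot>\<^bsub>H\<^esub> h\<^sub>2))) = r"
  shows "sweedler D H (ract_rho d h) f = r"
  unfolding assms(5)[symmetric] ract_rho_def rho_ract[OF assms(2,3)]
  by (insert assms(1-4),
    (assumption | rule sweedler_of_sweedler[where X = X] sweedler_of_tens[where X = X]
        sweedler_match calc_rules refl)+)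

lemma SR_ract_SL_lact:
  assumes "vspace X" "c \<in> carrier D" "d \<in> carrier D" "bilinear_on D D X f"
    and "SR c (\<lambda>a g. SL d (\<lambda>h b. f (a \<lhd> h) (g \<rhd> b))) = r"
  shows "sweedler D D (tens D D c d) f = r"
  unfolding assms(5)[symmetric] rho_ract_lam_lact[symmetric, OF assms(2,3)]
  by (insert assms(1-4),
    (assumption | rule sweedler_of_sweedler[where X = X] sweedler_of_tens[where X = X]
        sweedler_match calc_rules refl)+)

section \<open>Normal forms for iterated comultiplications and coactions\<close>

lemma coassoc_H: "h \<in> carrier H \<Longrightarrow>
    SH h (\<lambda>y z. SH y (\<lambda>p q. tens H (H \<Otimes> H) p (tens H H q z))) =
    SH h (\<lambda>y z. SH z (\<lambda>p q. tens H (H \<Otimes> H) y (tens H H p q)))"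
  and coassoc_D: "d \<in> carrier D \<Longrightarrow>
    SD d (\<lambda>y z. SD y (\<lambda>p q. tens D (D \<Otimes> D) p (tens D D q z))) =
    SD d (\<lambda>y z. SD z (\<lambda>p q. tens D (D \<Otimes> D) y (tens D D p q)))"
  using bialgebra_H coalgebra_D by (auto simp: bialgebra_def coalgebra_def)

text \<open>Oriented towards nesting on the right. The second comultiplication may lie below other
  sums in \<open>e\<close>; the premise on \<open>pulls_out\<close> brings it forward, and
  \<open>lift3\<close> carries coassociativity over to \<open>f\<close>.\<close>

lemma SH_coassoc:
  assumes "vspace X" "h \<in> carrier H"
    and "\<And>y z. pulls_out (e y z) H H (\<Delta>\<^bsub>H\<^esub> y) (\<lambda>p q. f p q z)"
    and "trilinear_on H H H X f"
    and "SH h (\<lambda>y z. SH z (\<lambda>p q. f y p q)) = r"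
  shows "SH h e = r"
proof -
  have "SH h e = SH h (\<lambda>y z. SH y (\<lambda>p q. f p q z))"
    using assms(3) unfolding pulls_out_def by presburger
  also have "\<dots> = SH h (\<lambda>y z. SH z (\<lambda>p q. f y p q))"
    by (rule lift3_transfer[where U = H and V = H and W = H and f = f, OF coassoc_H[OF assms(2)]],
        insert assms(1,2,4),
        (assumption | rule lift3_sweedler[where X = X] lift3_tens[where X = X] calc_rules)+)
  finally show ?thesis using assms(5) by simp
qed

lemma SD_coassoc:
  assumes "vspace X" "d \<in> carrier D"
    and "\<And>y z. pulls_out (e y z) D D (\<Delta>\<^bsub>D\<^esub> y) (\<lambda>p q. f p q z)"
    and "trilinear_on D D D X f"
    and "SD d (\<lambda>y z. SD z (\<lambda>p q. f y p q)) = r"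
  shows "SD d e = r"
proof -
  have "SD d e = SD d (\<lambda>y z. SD y (\<lambda>p q. f p q z))"
    using assms(3) unfolding pulls_out_def by presburger
  also have "\<dots> = SD d (\<lambda>y z. SD z (\<lambda>p q. f y p q))"
    by (rule lift3_transfer[where U = D and V = D and W = D and f = f, OF coassoc_D[OF assms(2)]],
        insert assms(1,2,4),
        (assumption | rule lift3_sweedler[where X = X] lift3_tens[where X = X] calc_rules)+)
  finally show ?thesis using assms(5) by simp
qed

text \<open>Read so that a comultiplication of the \<open>H\<close>-component of a coaction becomes
  a second coaction on \<open>D\<close>. With \<open>SL_coassoc\<close> oriented alike, coaction
  components are no longer comultiplied in the normal form.\<close>

lemma SR_coassoc:
  assumes "vspace X" "d \<in> carrier D"
    and "\<And>y z. pulls_out (e y z) H H (\<Delta>\<^bsub>H\<^esub> z) (\<lambda>p q. f y p q)"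
    and "trilinear_on D H H X f"
    and "SR d (\<lambda>a h. SR a (\<lambda>b g. f b g h)) = r"
  shows "SR d e = r"
proof -
  have "SR d e = SR d (\<lambda>y z. SH z (\<lambda>p q. f y p q))"
    using assms(3) unfolding pulls_out_def by presburger
  also have "\<dots> = SR d (\<lambda>a h. SR a (\<lambda>b g. f b g h))"
    by (rule lift3_transfer[where U = D and V = H and W = H and f = f, OF rho_coassoc[OF assms(2), symmetric]],
        insert assms(1,2,4),
        (assumption | rule lift3_sweedler[where X = X] lift3_tens[where X = X] calc_rules)+)
  finally show ?thesis using assms(5) by simp
qed

lemma SL_coassoc:
  assumes "vspace X" "d \<in> carrier D"
    and "\<And>y z. pulls_out (e y z) H H (\<Delta>\<^bsub>H\<^esub> y) (\<lambda>p q. f p q z)"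
    and "trilinear_on H H D X f"
    and "SL d (\<lambda>h a. SL a (\<lambda>g b. f h g b)) = r"
  shows "SL d e = r"
proof -
  have "SL d e = SL d (\<lambda>y z. SH y (\<lambda>p q. f p q z))"
    using assms(3) unfolding pulls_out_def by presburger
  also have "\<dots> = SL d (\<lambda>h a. SL a (\<lambda>g b. f h g b))"
    by (rule lift3_transfer[where U = H and V = H and W = D and f = f, OF lam_coassoc[OF assms(2)]],
        insert assms(1,2,4),
        (assumption | rule lift3_sweedler[where X = X] lift3_tens[where X = X] calc_rules)+)
  finally show ?thesis using assms(5) by simp
qed

text \<open>Fixes an order for the two commuting coactions on one element: the left coaction goes
  outside.\<close>

lemma SR_SL:
  assumes "vspace X" "d \<in> carrier D"
    and "\<And>y z. pulls_out (e y z) H D (lam y) (\<lambda>p q. f p q z)"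
    and "trilinear_on H D H X f"
    and "SL d (\<lambda>g a. SR a (\<lambda>b h. f g b h)) = r"
  shows "SR d e = r"
proof -
  have "SR d e = SR d (\<lambda>y z. SL y (\<lambda>p q. f p q z))"
    using assms(3) unfolding pulls_out_def by presburger
  also have "\<dots> = SL d (\<lambda>g a. SR a (\<lambda>b h. f g b h))"
    by (rule lift3_transfer[where U = H and V = D and W = H and f = f, OF rho_lam[OF assms(2)]],
        insert assms(1,2,4),
        (assumption | rule lift3_sweedler[where X = X] lift3_tens[where X = X] calc_rules)+)
  finally show ?thesis using assms(5) by simp
qed

text \<open>Moves the comultiplication of \<open>D\<close> outside the coaction, at the price of a
  product of two coaction components. \<open>SL_SD\<close> does the same on the left.\<close>

lemma SR_SD:
  assumes "vspace X" "d \<in> carrier D"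
    and "\<And>y z. pulls_out (e y z) D D (\<Delta>\<^bsub>D\<^esub> y) (\<lambda>p q. f p q z)"
    and "trilinear_on D D H X f"
    and "SD d (\<lambda>d\<^sub>1 d\<^sub>2. SR d\<^sub>1 (\<lambda>a g. SR d\<^sub>2 (\<lambda>b h. f a b (g \<cdot>\<^bsub>H\<^esub> h)))) = r"
  shows "SR d e = r"
proof -
  have "SR d e = SR d (\<lambda>y z. SD y (\<lambda>p q. f p q z))"
    using assms(3) unfolding pulls_out_def by presburger
  also have "\<dots> = SD d (\<lambda>d\<^sub>1 d\<^sub>2. SR d\<^sub>1 (\<lambda>a g. SR d\<^sub>2 (\<lambda>b h. f a b (g \<cdot>\<^bsub>H\<^esub> h))))"
    by (rule lift3_transfer[where U = D and V = D and W = H and f = f, OF rho_comult[OF assms(2), symmetric]],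
        insert assms(1,2,4),
        (assumption | rule lift3_sweedler[where X = X] lift3_tens[where X = X] calc_rules)+)
  finally show ?thesis using assms(5) by simp
qed

lemma SL_SD:
  assumes "vspace X" "d \<in> carrier D"
    and "\<And>y z. pulls_out (e y z) D D (\<Delta>\<^bsub>D\<^esub> z) (\<lambda>p q. f y p q)"
    and "trilinear_on H D D X f"
    and "SD d (\<lambda>d\<^sub>1 d\<^sub>2. SL d\<^sub>1 (\<lambda>g a. SL d\<^sub>2 (\<lambda>h b. f (g \<cdot>\<^bsub>H\<^esub> h) a b))) = r"
  shows "SL d e = r"
proof -
  have "SL d e = SL d (\<lambda>y z. SD z (\<lambda>p q. f y p q))"
    using assms(3) unfolding pulls_out_def by presburger
  also have "\<dots> = SD d (\<lambda>d\<^sub>1 d\<^sub>2. SL d\<^sub>1 (\<lambda>g a. SL d\<^sub>2 (\<lambda>h b. f (g \<cdot>\<^bsub>H\<^esub> h) a b)))"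
    by (rule lift3_transfer[where U = H and V = D and W = D and f = f, OF lam_comult[OF assms(2), symmetric]],
        insert assms(1,2,4),
        (assumption | rule lift3_sweedler[where X = X] lift3_tens[where X = X] calc_rules)+)
  finally show ?thesis using assms(5) by simp
qed

lemmas calc_expand =
  sweedler_of_tens sweedler_of_sweedler
  SH_mult SD_lact SD_ract SD_mult SR_mult SL_mult SR_lact SL_ract

text \<open>The rotation puts the search premise first, so that a failing search rejects the rule at once.\<close>

lemmas calc_move = SH_coassoc[rotated 2] SD_coassoc[rotated 2] SR_coassoc[rotated 2]
  SL_coassoc[rotated 2] SR_SL[rotated 2] SR_SD[rotated 2] SL_SD[rotated 2]

lemma lact_lam_in_carrier:
  assumes "h \<in> carrier H" "d \<in> carrier D"
  shows "lact_lam h d \<in> carrier (H \<Otimes> D)"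
  unfolding lact_lam_def by (insert assms, (assumption | rule calc_closed)+)

lemma ract_rho_in_carrier:
  assumes "d \<in> carrier D" "h \<in> carrier H"
  shows "ract_rho d h \<in> carrier (D \<Otimes> H)"
  unfolding ract_rho_def by (insert assms, (assumption | rule calc_closed)+)

section \<open>Algebra laws of \<open>H\<close> and \<open>D\<close>\<close>

lemma mult_assoc:
  shows "x \<in> carrier H \<Longrightarrow> y \<in> carrier H \<Longrightarrow> z \<in> carrier H \<Longrightarrow>
      (x \<cdot>\<^bsub>H\<^esub> y) \<cdot>\<^bsub>H\<^esub> z = x \<cdot>\<^bsub>H\<^esub> (y \<cdot>\<^bsub>H\<^esub> z)"
    and "a \<in> carrier D \<Longrightarrow> b \<in> carrier D \<Longrightarrow> c \<in> carrier D \<Longrightarrow>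
      (a \<cdot>\<^bsub>D\<^esub> b) \<cdot>\<^bsub>D\<^esub> c = a \<cdot>\<^bsub>D\<^esub> (b \<cdot>\<^bsub>D\<^esub> c)"
  using bialgebra_H algebra_D by (auto simp: bialgebra_def algebra_def)

lemma unit_closed: "\<one>\<^bsub>H\<^esub> \<in> carrier H" "\<one>\<^bsub>D\<^esub> \<in> carrier D"
  using bialgebra_H algebra_D by (auto simp: bialgebra_def algebra_def)

lemma mult_one:
  shows "h \<in> carrier H \<Longrightarrow> \<one>\<^bsub>H\<^esub> \<cdot>\<^bsub>H\<^esub> h = h" "h \<in> carrier H \<Longrightarrow> h \<cdot>\<^bsub>H\<^esub> \<one>\<^bsub>H\<^esub> = h"
    and "d \<in> carrier D \<Longrightarrow> \<one>\<^bsub>D\<^esub> \<cdot>\<^bsub>D\<^esub> d = d" "d \<in> carrier D \<Longrightarrow> d \<cdot>\<^bsub>D\<^esub> \<one>\<^bsub>D\<^esub> = d"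
  using bialgebra_H algebra_D by (auto simp: bialgebra_def algebra_def)

section \<open>The biproduct\<close>

abbreviation P where "P \<equiv> D \<Otimes> H"

abbreviation T4 :: "'d \<Rightarrow> 'h \<Rightarrow> 'd \<Rightarrow> 'h \<Rightarrow> _" where
  "T4 a p b q \<equiv> tens P P (tens D H a p) (tens D H b q)"

section \<open>The underlying vector space of the biproduct\<close>

lemma biproduct_carrier: "carrier B = carrier P" "smult B = smult P" "\<one>\<^bsub>B\<^esub> = tens D H \<one>\<^bsub>D\<^esub> \<one>\<^bsub>H\<^esub>"
  by (simp_all add: LR_smash_biproduct_def)

text \<open>\<open>B\<close> and \<open>P\<close> are records of different types, but linearity
  depends only on the carrier and the scalar multiplication. The same reason lets tensor products
  and Sweedler sums over \<open>B\<close> be replaced by those over \<open>P\<close>.\<close>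

lemma linear_on_biproduct:
  "linear_on B X f = linear_on P X f" "linear_on Y B g = linear_on Y P g"
  by (simp_all add: linear_on_def biproduct_carrier)

lemma bilinear_on_biproduct:
  "bilinear_on B Y X f = bilinear_on P Y X f" "bilinear_on Y B X g = bilinear_on Y P X g"
  "bilinear_on V W B k = bilinear_on V W P k"
  by (simp_all add: bilinear_on_def linear_on_biproduct biproduct_carrier)

lemma tens_biproduct: "tens B Y = tens P Y" "tens Y B = tens Y P"
  by (simp_all add: tens_def fun_eq_iff bilinear_on_biproduct)

lemma tensor_space_biproduct: "B \<Otimes> Y = P \<Otimes> Y" "Y \<Otimes> B = Y \<Otimes> P"
  unfolding tensor_space_def[of B] tensor_space_def[of P] tensor_space_def[of Y]
    tens_biproduct biproduct_carrier by (rule refl)+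

lemma sweedler_biproduct: "sweedler B B = sweedler P P"
  by (simp add: sweedler_def tensor_rep_def tens_biproduct biproduct_carrier fun_eq_iff)

lemma vspace_biproduct: "vspace B"
  using vspace_tensor_space[of D H] by (simp add: vspace_def biproduct_carrier)

lemmas biproduct_space = biproduct_carrier linear_on_biproduct bilinear_on_biproduct tens_biproduct
  tensor_space_biproduct sweedler_biproduct

section \<open>Linearity of the operations and their expansion on simple tensors\<close>

lemma bilinear_biproduct_mult: "bilinear_on P P P (mult B)"
  unfolding LR_smash_biproduct_def alg_coalg.simps
  by (assumption | rule calc_linear calc_closed)+

lemma linear_biproduct_comult: "linear_on P (P \<Otimes> P) \<Delta>\<^bsub>B\<^esub>"
  unfolding LR_smash_biproduct_def alg_coalg.simps
  by (assumption | rule calc_linear calc_closed)+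

lemma linear_biproduct_counit: "linear_on P scalars \<epsilon>\<^bsub>B\<^esub>"
  unfolding LR_smash_biproduct_def alg_coalg.simps
  by (assumption | rule calc_linear calc_closed bilinear_on_scalar_mult[THEN linear_on_fun_left]
      bilinear_on_scalar_mult[THEN linear_on_fun_right])+

lemmas biproduct_linear =
  bilinear_biproduct_mult[THEN linear_on_fun_left] bilinear_biproduct_mult[THEN linear_on_fun_right]
  linear_on_compose[OF _ linear_biproduct_comult] linear_on_compose[OF _ linear_biproduct_counit]
  bilinear_biproduct_mult[THEN bilinear_onD] linear_biproduct_comult[THEN linear_onD(1)]
  linear_biproduct_counit[THEN linear_onD(1)]

lemma biproduct_mult_tensI:
  assumes "d \<in> carrier D" "h \<in> carrier H" "e \<in> carrier D" "k \<in> carrier H"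
    and "SH h (\<lambda>h\<^sub>1 h\<^sub>2. SH k (\<lambda>k\<^sub>1 k\<^sub>2.
      tens D H ((d \<lhd> k\<^sub>2) \<cdot>\<^bsub>D\<^esub> (h\<^sub>1 \<rhd> e)) (h\<^sub>2 \<cdot>\<^bsub>H\<^esub> k\<^sub>1))) = r"
  shows "tens D H d h \<cdot>\<^bsub>B\<^esub> tens D H e k = r"
  using biproduct_mult_tens[OF assms(1-4)] assms(5) by simp

lemma biproduct_comult_tensI:
  assumes "d \<in> carrier D" "h \<in> carrier H"
    and "SD d (\<lambda>d\<^sub>1 d\<^sub>2. SH h (\<lambda>h\<^sub>1 h\<^sub>2. SR d\<^sub>1 (\<lambda>a u. SL d\<^sub>2 (\<lambda>v b.
      T4 a (v \<cdot>\<^bsub>H\<^esub> h\<^sub>1) b (h\<^sub>2 \<cdot>\<^bsub>H\<^esub> u))))) = r"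
  shows "\<Delta>\<^bsub>B\<^esub> (tens D H d h) = r"
  using biproduct_comult_tens[OF assms(1,2)] assms(3) by simp

text \<open>A product of simple tensors is a sum, so an operation applied to it must first pass
  through that sum. The map \<open>\<phi>\<close> is the counit, the comultiplication, or tensoring
  or multiplying with a fixed element.\<close>

lemma apply_biproduct_mult:
  assumes "linear_on P X \<phi>" "d \<in> carrier D" "h \<in> carrier H" "e \<in> carrier D" "k \<in> carrier H"
    and "SH h (\<lambda>h\<^sub>1 h\<^sub>2. SH k (\<lambda>k\<^sub>1 k\<^sub>2.
      \<phi> (tens D H ((d \<lhd> k\<^sub>2) \<cdot>\<^bsub>D\<^esub> (h\<^sub>1 \<rhd> e)) (h\<^sub>2 \<cdot>\<^bsub>H\<^esub> k\<^sub>1)))) = r"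
  shows "\<phi> (tens D H d h \<cdot>\<^bsub>B\<^esub> tens D H e k) = r"
  unfolding biproduct_mult_tens[OF assms(2-5)] assms(6)[symmetric]
  by (insert assms(2-5), (assumption
    | rule linear_on_sweedler_apply[OF assms(1)] linear_on_sweedler_apply[OF assms(1), OF _ _ _ _ _ refl]
        calc_closed refl)+)

lemma sweedler_biproduct_comult:
  assumes "vspace X" "bilinear_on P P X f" "d \<in> carrier D" "h \<in> carrier H"
    and "SD d (\<lambda>d\<^sub>1 d\<^sub>2. SH h (\<lambda>h\<^sub>1 h\<^sub>2. SR d\<^sub>1 (\<lambda>a u. SL d\<^sub>2 (\<lambda>v b.
      f (tens D H a (v \<cdot>\<^bsub>H\<^esub> h\<^sub>1)) (tens D H b (h\<^sub>2 \<cdot>\<^bsub>H\<^esub> u)))))) = r"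
  shows "sweedler P P (\<Delta>\<^bsub>B\<^esub> (tens D H d h)) f = r"
  unfolding biproduct_comult_tens[OF assms(3,4)] assms(5)[symmetric]
  by (insert assms(1-4), (assumption
    | rule sweedler_of_tens[where X = X] sweedler_of_sweedler[where X = X]
    | (rule sweedler_match, (rule pull_rules)+)
    | rule calc_linear calc_closed refl)+)

lemma tens_mult_left:
  assumes "d \<in> carrier D" "h \<in> carrier H" "e \<in> carrier D" "k \<in> carrier H" "y \<in> carrier P"
    and "SH h (\<lambda>h\<^sub>1 h\<^sub>2. SH k (\<lambda>k\<^sub>1 k\<^sub>2.
      tens P P (tens D H ((d \<lhd> k\<^sub>2) \<cdot>\<^bsub>D\<^esub> (h\<^sub>1 \<rhd> e)) (h\<^sub>2 \<cdot>\<^bsub>H\<^esub> k\<^sub>1)) y)) = r"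
  shows "tens P P (tens D H d h \<cdot>\<^bsub>B\<^esub> tens D H e k) y = r"
  by (rule apply_biproduct_mult[where \<phi> = "\<lambda>x. tens P P x y"])
    (insert assms, (assumption | rule calc_linear calc_closed)+)

lemma tens_mult_right:
  assumes "d \<in> carrier D" "h \<in> carrier H" "e \<in> carrier D" "k \<in> carrier H" "y \<in> carrier P"
    and "SH h (\<lambda>h\<^sub>1 h\<^sub>2. SH k (\<lambda>k\<^sub>1 k\<^sub>2.
      tens P P y (tens D H ((d \<lhd> k\<^sub>2) \<cdot>\<^bsub>D\<^esub> (h\<^sub>1 \<rhd> e)) (h\<^sub>2 \<cdot>\<^bsub>H\<^esub> k\<^sub>1)))) = r"
  shows "tens P P y (tens D H d h \<cdot>\<^bsub>B\<^esub> tens D H e k) = r"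
  by (rule apply_biproduct_mult[where \<phi> = "\<lambda>x. tens P P y x"])
    (insert assms, (assumption | rule calc_linear calc_closed)+)

section \<open>Counit laws under a sum\<close>

lemmas calc_smult = linear_on_smult_right linear_on_smult_left vspace_smult

lemma counit_eqs:
  "h \<in> carrier H \<Longrightarrow> SH h (\<lambda>h\<^sub>1 h\<^sub>2. \<epsilon>\<^bsub>H\<^esub> h\<^sub>1 \<cdot>\<^sub>s\<^bsub>H\<^esub> h\<^sub>2) = h"
  "h \<in> carrier H \<Longrightarrow> SH h (\<lambda>h\<^sub>1 h\<^sub>2. \<epsilon>\<^bsub>H\<^esub> h\<^sub>2 \<cdot>\<^sub>s\<^bsub>H\<^esub> h\<^sub>1) = h"
  "d \<in> carrier D \<Longrightarrow> SD d (\<lambda>d\<^sub>1 d\<^sub>2. \<epsilon>\<^bsub>D\<^esub> d\<^sub>1 \<cdot>\<^sub>s\<^bsub>D\<^esub> d\<^sub>2) = d"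
  "d \<in> carrier D \<Longrightarrow> SD d (\<lambda>d\<^sub>1 d\<^sub>2. \<epsilon>\<^bsub>D\<^esub> d\<^sub>2 \<cdot>\<^sub>s\<^bsub>D\<^esub> d\<^sub>1) = d"
  "\<epsilon>\<^bsub>H\<^esub> \<one>\<^bsub>H\<^esub> = 1"
  "g \<in> carrier H \<Longrightarrow> h \<in> carrier H \<Longrightarrow> \<epsilon>\<^bsub>H\<^esub> (g \<cdot>\<^bsub>H\<^esub> h) = \<epsilon>\<^bsub>H\<^esub> g * \<epsilon>\<^bsub>H\<^esub> h"
  using bialgebra_H coalgebra_D by (auto simp: bialgebra_def coalgebra_def)

lemmas counit_rules = calc_closed counit_eqs rho_counit lam_counit rho_counit_D lam_counit_D

text \<open>The counit axiom composed with a linear map. The rule sees only a counit that is the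
  leading scalar of the summand, which dictates the order of scalars in the calculations
  below.\<close>

lemma SH_counit_left:
  assumes "linear_on H X f" "h \<in> carrier H" "f h = r"
  shows "SH h (\<lambda>a b. \<epsilon>\<^bsub>H\<^esub> a \<cdot>\<^sub>s\<^bsub>X\<^esub> f b) = r"
  by (rule trans[OF sweedler_smult_linear[OF assms(1), where g = "\<lambda>a b. b"]])
    (insert assms unit_closed,
      (assumption | rule counit_rules linear_onD(3)[OF assms(1), THEN trans])+)

lemma SH_counit_right:
  assumes "linear_on H X f" "h \<in> carrier H" "f h = r"
  shows "SH h (\<lambda>a b. \<epsilon>\<^bsub>H\<^esub> b \<cdot>\<^sub>s\<^bsub>X\<^esub> f a) = r"
  by (rule trans[OF sweedler_smult_linear[OF assms(1), where g = "\<lambda>a b. a"]])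
    (insert assms unit_closed,
      (assumption | rule counit_rules linear_onD(3)[OF assms(1), THEN trans])+)

text \<open>By \<open>rho_counit_D\<close> the counit of \<open>D\<close> trivialises the coaction,
  so the remaining leg is evaluated at the unit of \<open>H\<close>.\<close>

lemma SR_counit_D:
  assumes "linear_on H X f" "d \<in> carrier D" "\<epsilon>\<^bsub>D\<^esub> d \<cdot>\<^sub>s\<^bsub>X\<^esub> f \<one>\<^bsub>H\<^esub> = r"
  shows "SR d (\<lambda>a u. \<epsilon>\<^bsub>D\<^esub> a \<cdot>\<^sub>s\<^bsub>X\<^esub> f u) = r"
  by (rule trans[OF sweedler_smult_linear[OF assms(1), where g = "\<lambda>a b. b"]])
    (insert assms unit_closed,
      (assumption | rule counit_rules linear_onD(3)[OF assms(1), THEN trans])+)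

lemma SL_counit_D:
  assumes "linear_on H X f" "d \<in> carrier D" "\<epsilon>\<^bsub>D\<^esub> d \<cdot>\<^sub>s\<^bsub>X\<^esub> f \<one>\<^bsub>H\<^esub> = r"
  shows "SL d (\<lambda>v b. \<epsilon>\<^bsub>D\<^esub> b \<cdot>\<^sub>s\<^bsub>X\<^esub> f v) = r"
  by (rule trans[OF sweedler_smult_linear[OF assms(1), where g = "\<lambda>a b. a"]])
    (insert assms unit_closed,
      (assumption | rule counit_rules linear_onD(3)[OF assms(1), THEN trans])+)

lemma SD_counit_left:
  assumes "linear_on D X f" "d \<in> carrier D" "f d = r"
  shows "SD d (\<lambda>a b. \<epsilon>\<^bsub>D\<^esub> a \<cdot>\<^sub>s\<^bsub>X\<^esub> f b) = r"
  by (rule trans[OF sweedler_smult_linear[OF assms(1), where g = "\<lambda>a b. b"]])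
    (insert assms unit_closed,
      (assumption | rule counit_rules linear_onD(3)[OF assms(1), THEN trans])+)

lemma SD_counit_right:
  assumes "linear_on D X f" "d \<in> carrier D" "f d = r"
  shows "SD d (\<lambda>a b. \<epsilon>\<^bsub>D\<^esub> b \<cdot>\<^sub>s\<^bsub>X\<^esub> f a) = r"
  by (rule trans[OF sweedler_smult_linear[OF assms(1), where g = "\<lambda>a b. a"]])
    (insert assms unit_closed,
      (assumption | rule counit_rules linear_onD(3)[OF assms(1), THEN trans])+)

lemma SR_counit:
  assumes "linear_on D X f" "d \<in> carrier D" "f d = r"
  shows "SR d (\<lambda>a u. \<epsilon>\<^bsub>H\<^esub> u \<cdot>\<^sub>s\<^bsub>X\<^esub> f a) = r"
  by (rule trans[OF sweedler_smult_linear[OF assms(1), where g = "\<lambda>a b. a"]])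
    (insert assms unit_closed,
      (assumption | rule counit_rules linear_onD(3)[OF assms(1), THEN trans])+)

lemma SL_counit:
  assumes "linear_on D X f" "d \<in> carrier D" "f d = r"
  shows "SL d (\<lambda>v b. \<epsilon>\<^bsub>H\<^esub> v \<cdot>\<^sub>s\<^bsub>X\<^esub> f b) = r"
  by (rule trans[OF sweedler_smult_linear[OF assms(1), where g = "\<lambda>a b. b"]])
    (insert assms unit_closed,
      (assumption | rule counit_rules linear_onD(3)[OF assms(1), THEN trans])+)

lemmas calc_counit = SH_counit_left SH_counit_right SR_counit_D SL_counit_D
  SD_counit_left SD_counit_right SR_counit SL_counit

text \<open>Iterated comultiplications nested on the right, as \<open>SH_coassoc\<close> produces
  them. In \<open>SR2\<close> and \<open>SL2\<close> the arguments of \<open>f\<close> follow the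
  order of the tensor factors.\<close>

abbreviation SH3 :: "'h \<Rightarrow> ('h \<Rightarrow> 'h \<Rightarrow> 'h \<Rightarrow> 'x::ab_group_add) \<Rightarrow> 'x" where
  "SH3 h f \<equiv> SH h (\<lambda>h\<^sub>1 r. SH r (\<lambda>h\<^sub>2 h\<^sub>3. f h\<^sub>1 h\<^sub>2 h\<^sub>3))"
abbreviation SH4 :: "'h \<Rightarrow> ('h \<Rightarrow> 'h \<Rightarrow> 'h \<Rightarrow> 'h \<Rightarrow> 'x::ab_group_add) \<Rightarrow> 'x" where
  "SH4 h f \<equiv> SH h (\<lambda>h\<^sub>1 r. SH r (\<lambda>h\<^sub>2 s. SH s (\<lambda>h\<^sub>3 h\<^sub>4. f h\<^sub>1 h\<^sub>2 h\<^sub>3 h\<^sub>4)))"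
abbreviation SR2 :: "'d \<Rightarrow> ('d \<Rightarrow> 'h \<Rightarrow> 'h \<Rightarrow> 'x::ab_group_add) \<Rightarrow> 'x" where
  "SR2 d f \<equiv> SR d (\<lambda>a y. SR a (\<lambda>b x. f b x y))"
abbreviation SL2 :: "'d \<Rightarrow> ('h \<Rightarrow> 'h \<Rightarrow> 'd \<Rightarrow> 'x::ab_group_add) \<Rightarrow> 'x" where
  "SL2 d f \<equiv> SL d (\<lambda>v a. SL a (\<lambda>w b. f v w b))"

section \<open>Unit and counit on simple tensors\<close>

lemma biproduct_one_left:
  assumes "d \<in> carrier D" "h \<in> carrier H"
  shows "tens D H \<one>\<^bsub>D\<^esub> \<one>\<^bsub>H\<^esub> \<cdot>\<^bsub>B\<^esub> tens D H d h = tens D H d h"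
proof -
  \<comment> \<open>By \<open>unit_ract\<close> the action on the unit is the scalar counit of
    \<open>k\<^sub>2\<close>, which moves out of the product and the tensor. The counit axiom of
    \<open>H\<close> then removes it.\<close>
  have *: "tens D H ((\<one>\<^bsub>D\<^esub> \<lhd> k\<^sub>2) \<cdot>\<^bsub>D\<^esub> (\<one>\<^bsub>H\<^esub> \<rhd> d)) (\<one>\<^bsub>H\<^esub> \<cdot>\<^bsub>H\<^esub> k\<^sub>1) = \<epsilon>\<^bsub>H\<^esub> k\<^sub>2 \<cdot>\<^sub>s\<^bsub>P\<^esub> tens D H d k\<^sub>1"
    if "k\<^sub>1 \<in> carrier H" "k\<^sub>2 \<in> carrier H" for k\<^sub>1 k\<^sub>2
    using that assms linear_onD(3)[OF bilinear_onD2[OF structure_simps(4)], of d "\<one>\<^bsub>D\<^esub>" "\<epsilon>\<^bsub>H\<^esub> k\<^sub>2"]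
      linear_onD(3)[OF bilinear_onD2[OF bilinear_on_tens[OF structure_simps(2,1)]], of k\<^sub>1 d "\<epsilon>\<^bsub>H\<^esub> k\<^sub>2"]
    by (simp add: unit_ract one_lact mult_one unit_closed)
  have "tens D H \<one>\<^bsub>D\<^esub> \<one>\<^bsub>H\<^esub> \<cdot>\<^bsub>B\<^esub> tens D H d h = SH h (\<lambda>k\<^sub>1 k\<^sub>2. \<epsilon>\<^bsub>H\<^esub> k\<^sub>2 \<cdot>\<^sub>s\<^bsub>P\<^esub> tens D H d k\<^sub>1)"
    by (rule biproduct_mult_tensI, (fact assms unit_closed)+, unfold comult_H_one)
      (insert assms unit_closed, (assumption | rule sweedler_of_tens[where X = P] *
      | (rule sweedler_match, (rule pull_rules)+)
      | rule calc_linear calc_closed)+)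
  also have "\<dots> = tens D H d h"
    by (insert assms, (assumption | rule calc_counit calc_linear calc_closed refl)+)
  finally show ?thesis .
qed

lemma biproduct_one_right:
  assumes "d \<in> carrier D" "h \<in> carrier H"
  shows "tens D H d h \<cdot>\<^bsub>B\<^esub> tens D H \<one>\<^bsub>D\<^esub> \<one>\<^bsub>H\<^esub> = tens D H d h"
proof -
  have *: "tens D H ((d \<lhd> \<one>\<^bsub>H\<^esub>) \<cdot>\<^bsub>D\<^esub> (h\<^sub>1 \<rhd> \<one>\<^bsub>D\<^esub>)) (h\<^sub>2 \<cdot>\<^bsub>H\<^esub> \<one>\<^bsub>H\<^esub>) = \<epsilon>\<^bsub>H\<^esub> h\<^sub>1 \<cdot>\<^sub>s\<^bsub>P\<^esub> tens D H d h\<^sub>2"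
    if "h\<^sub>1 \<in> carrier H" "h\<^sub>2 \<in> carrier H" for h\<^sub>1 h\<^sub>2
    using that assms linear_onD(3)[OF bilinear_onD1[OF structure_simps(4)], of d "\<one>\<^bsub>D\<^esub>" "\<epsilon>\<^bsub>H\<^esub> h\<^sub>1"]
      linear_onD(3)[OF bilinear_onD2[OF bilinear_on_tens[OF structure_simps(2,1)]], of h\<^sub>2 d "\<epsilon>\<^bsub>H\<^esub> h\<^sub>1"]
    by (simp add: lact_unit ract_one mult_one unit_closed)
  have "tens D H d h \<cdot>\<^bsub>B\<^esub> tens D H \<one>\<^bsub>D\<^esub> \<one>\<^bsub>H\<^esub> = SH h (\<lambda>h\<^sub>1 h\<^sub>2. \<epsilon>\<^bsub>H\<^esub> h\<^sub>1 \<cdot>\<^sub>s\<^bsub>P\<^esub> tens D H d h\<^sub>2)"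
    by (rule biproduct_mult_tensI, (fact assms unit_closed)+, unfold comult_H_one)
      (insert assms unit_closed, (assumption | rule sweedler_of_tens[where X = P] *
      | (rule sweedler_match, (rule pull_rules)+)
      | rule calc_linear calc_closed)+)
  also have "\<dots> = tens D H d h"
    by (insert assms, (assumption | rule calc_counit calc_linear calc_closed refl)+)
  finally show ?thesis .
qed

text \<open>The counit of \<open>D\<close> is multiplicative and splits off the actions, so each of
  the four legs of \<open>h\<close> and \<open>k\<close> contributes its own counit; the counit
  axiom of \<open>H\<close> reassembles \<open>h\<close> and \<open>k\<close>.\<close>

lemma biproduct_counit_mult:
  assumes "d \<in> carrier D" "h \<in> carrier H" "e \<in> carrier D" "k \<in> carrier H"
  shows "\<epsilon>\<^bsub>B\<^esub> (tens D H d h \<cdot>\<^bsub>B\<^esub> tens D H e k) = \<epsilon>\<^bsub>B\<^esub> (tens D H d h) * \<epsilon>\<^bsub>B\<^esub> (tens D H e k)"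
proof -
  \<comment> \<open>Products of counit values are written as scalar multiples in
    \<open>scalars\<close>, the form to which the counit rules apply.\<close>
  have smult: "smult scalars = (*)" by (simp add: scalars_def)
  have "\<epsilon>\<^bsub>B\<^esub> (tens D H d h \<cdot>\<^bsub>B\<^esub> tens D H e k) =
      SH k (\<lambda>k\<^sub>1 k\<^sub>2. SH h (\<lambda>h\<^sub>1 h\<^sub>2. \<epsilon>\<^bsub>H\<^esub> h\<^sub>1 \<cdot>\<^sub>s\<^bsub>scalars\<^esub> (\<epsilon>\<^bsub>H\<^esub> k\<^sub>1 \<cdot>\<^sub>s\<^bsub>scalars\<^esub>
        ((\<epsilon>\<^bsub>D\<^esub> d * \<epsilon>\<^bsub>D\<^esub> e) \<cdot>\<^sub>s\<^bsub>scalars\<^esub> \<epsilon>\<^bsub>H\<^esub> k\<^sub>2 \<cdot>\<^sub>s\<^bsub>scalars\<^esub> \<epsilon>\<^bsub>H\<^esub> h\<^sub>2))))"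
    by (rule apply_biproduct_mult[OF linear_biproduct_counit])
      (insert assms, (assumption | (rule sweedler_match, (rule pull_rules)+) | rule calc_closed
      | (simp add: smult biproduct_counit_tens calc_closed counit_mult counit_lact counit_ract counit_eqs; fail))+)
  also have "\<dots> = SH k (\<lambda>k\<^sub>1 k\<^sub>2. \<epsilon>\<^bsub>H\<^esub> k\<^sub>1 \<cdot>\<^sub>s\<^bsub>scalars\<^esub>
        ((\<epsilon>\<^bsub>D\<^esub> d * \<epsilon>\<^bsub>D\<^esub> e * \<epsilon>\<^bsub>H\<^esub> h) \<cdot>\<^sub>s\<^bsub>scalars\<^esub> \<epsilon>\<^bsub>H\<^esub> k\<^sub>2))"
    by (insert assms, (assumption | rule calc_counit[where X = scalars] | (rule sweedler_match, (rule pull_rules)+)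
      | rule calc_linear calc_closed calc_smult | (simp add: smult; fail))+)
  also have "\<dots> = \<epsilon>\<^bsub>B\<^esub> (tens D H d h) * \<epsilon>\<^bsub>B\<^esub> (tens D H e k)"
    by (insert assms, (assumption | rule calc_counit[where X = scalars]
      | rule calc_linear calc_closed calc_smult | (simp add: smult biproduct_counit_tens; fail))+)
  finally show ?thesis .
qed

text \<open>The sums collapse one after another: \<open>rho_counit_D\<close> turns \<open>u\<close>
  into the unit, \<open>lam_counit\<close> returns \<open>d\<^sub>2\<close>, and the counit axioms
  of \<open>D\<close> and \<open>H\<close> finish.\<close>

lemma biproduct_counit_left:
  assumes "d \<in> carrier D" "h \<in> carrier H"
  shows "sweedler P P (\<Delta>\<^bsub>B\<^esub> (tens D H d h)) (\<lambda>y z. \<epsilon>\<^bsub>B\<^esub> y \<cdot>\<^sub>s\<^bsub>P\<^esub> z) = tens D H d h"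
proof -
  note simps = biproduct_counit_tens calc_closed unit_closed counit_eqs mult_one
    smult_smult[OF vspace_tensor_space]
  note rules = calc_linear calc_closed calc_smult biproduct_linear unit_closed
  \<comment> \<open>The sums are ordered so that the first to collapse, over
    \<open>rho d\<^sub>1\<close>, is innermost and its counit leads. Each later step has the next
    counit in front.\<close>
  have "sweedler P P (\<Delta>\<^bsub>B\<^esub> (tens D H d h)) (\<lambda>y z. \<epsilon>\<^bsub>B\<^esub> y \<cdot>\<^sub>s\<^bsub>P\<^esub> z) =
      SH h (\<lambda>h\<^sub>1 h\<^sub>2. SD d (\<lambda>d\<^sub>1 d\<^sub>2. SL d\<^sub>2 (\<lambda>v b. SR d\<^sub>1 (\<lambda>a u.
        \<epsilon>\<^bsub>D\<^esub> a \<cdot>\<^sub>s\<^bsub>P\<^esub> \<epsilon>\<^bsub>H\<^esub> v \<cdot>\<^sub>s\<^bsub>P\<^esub> \<epsilon>\<^bsub>H\<^esub> h\<^sub>1 \<cdot>\<^sub>s\<^bsub>P\<^esub> tens D H b (h\<^sub>2 \<cdot>\<^bsub>H\<^esub> u)))))"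
    by (rule sweedler_biproduct_comult[where X = P])
      (insert assms, (assumption | (rule sweedler_match, (rule pull_rules)+) | rule rules
      | (simp add: simps mult.assoc; fail))+)
  also have "\<dots> = SH h (\<lambda>h\<^sub>1 h\<^sub>2. SD d (\<lambda>d\<^sub>1 d\<^sub>2. SL d\<^sub>2 (\<lambda>v b.
        \<epsilon>\<^bsub>H\<^esub> v \<cdot>\<^sub>s\<^bsub>P\<^esub> \<epsilon>\<^bsub>D\<^esub> d\<^sub>1 \<cdot>\<^sub>s\<^bsub>P\<^esub> \<epsilon>\<^bsub>H\<^esub> h\<^sub>1 \<cdot>\<^sub>s\<^bsub>P\<^esub> tens D H b h\<^sub>2)))"
    by (insert assms, (assumption | rule calc_counit[where X = P] | (rule sweedler_match, (rule pull_rules)+)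
      | rule rules | (simp add: simps ac_simps; fail))+)
  also have "\<dots> = SH h (\<lambda>h\<^sub>1 h\<^sub>2. SD d (\<lambda>d\<^sub>1 d\<^sub>2.
        \<epsilon>\<^bsub>D\<^esub> d\<^sub>1 \<cdot>\<^sub>s\<^bsub>P\<^esub> \<epsilon>\<^bsub>H\<^esub> h\<^sub>1 \<cdot>\<^sub>s\<^bsub>P\<^esub> tens D H d\<^sub>2 h\<^sub>2))"
    by (insert assms, (assumption | rule calc_counit[where X = P] | (rule sweedler_match, (rule pull_rules)+)
      | rule rules refl)+)
  also have "\<dots> = SH h (\<lambda>h\<^sub>1 h\<^sub>2. \<epsilon>\<^bsub>H\<^esub> h\<^sub>1 \<cdot>\<^sub>s\<^bsub>P\<^esub> tens D H d h\<^sub>2)"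
    by (insert assms, (assumption | rule calc_counit[where X = P] | (rule sweedler_match, (rule pull_rules)+)
      | rule rules refl)+)
  also have "\<dots> = tens D H d h"
    by (insert assms, (assumption | rule calc_counit[where X = P] rules refl)+)
  finally show ?thesis .
qed

text \<open>The mirror image: the sum over \<open>lam d\<^sub>2\<close> is innermost and collapses
  first by \<open>lam_counit_D\<close>, then \<open>rho_counit\<close> returns
  \<open>d\<^sub>1\<close>.\<close>

lemma biproduct_counit_right:
  assumes "d \<in> carrier D" "h \<in> carrier H"
  shows "sweedler P P (\<Delta>\<^bsub>B\<^esub> (tens D H d h)) (\<lambda>y z. \<epsilon>\<^bsub>B\<^esub> z \<cdot>\<^sub>s\<^bsub>P\<^esub> y) = tens D H d h"
proof -
  note simps = biproduct_counit_tens calc_closed unit_closed counit_eqs mult_one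
    smult_smult[OF vspace_tensor_space]
  note rules = calc_linear calc_closed calc_smult biproduct_linear unit_closed
  have "sweedler P P (\<Delta>\<^bsub>B\<^esub> (tens D H d h)) (\<lambda>y z. \<epsilon>\<^bsub>B\<^esub> z \<cdot>\<^sub>s\<^bsub>P\<^esub> y) =
      SH h (\<lambda>h\<^sub>1 h\<^sub>2. SD d (\<lambda>d\<^sub>1 d\<^sub>2. SR d\<^sub>1 (\<lambda>a u. SL d\<^sub>2 (\<lambda>v b.
        \<epsilon>\<^bsub>D\<^esub> b \<cdot>\<^sub>s\<^bsub>P\<^esub> \<epsilon>\<^bsub>H\<^esub> u \<cdot>\<^sub>s\<^bsub>P\<^esub> \<epsilon>\<^bsub>H\<^esub> h\<^sub>2 \<cdot>\<^sub>s\<^bsub>P\<^esub> tens D H a (v \<cdot>\<^bsub>H\<^esub> h\<^sub>1)))))"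
    by (rule sweedler_biproduct_comult[where X = P])
      (insert assms, (assumption | (rule sweedler_match, (rule pull_rules)+) | rule rules
      | (simp add: simps ac_simps; fail))+)
  also have "\<dots> = SH h (\<lambda>h\<^sub>1 h\<^sub>2. SD d (\<lambda>d\<^sub>1 d\<^sub>2. SR d\<^sub>1 (\<lambda>a u.
        \<epsilon>\<^bsub>H\<^esub> u \<cdot>\<^sub>s\<^bsub>P\<^esub> \<epsilon>\<^bsub>D\<^esub> d\<^sub>2 \<cdot>\<^sub>s\<^bsub>P\<^esub> \<epsilon>\<^bsub>H\<^esub> h\<^sub>2 \<cdot>\<^sub>s\<^bsub>P\<^esub> tens D H a h\<^sub>1)))"
    by (insert assms, (assumption | rule calc_counit[where X = P] | (rule sweedler_match, (rule pull_rules)+)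
      | rule rules | (simp add: simps ac_simps; fail))+)
  also have "\<dots> = SH h (\<lambda>h\<^sub>1 h\<^sub>2. SD d (\<lambda>d\<^sub>1 d\<^sub>2.
        \<epsilon>\<^bsub>D\<^esub> d\<^sub>2 \<cdot>\<^sub>s\<^bsub>P\<^esub> \<epsilon>\<^bsub>H\<^esub> h\<^sub>2 \<cdot>\<^sub>s\<^bsub>P\<^esub> tens D H d\<^sub>1 h\<^sub>1))"
    by (insert assms, (assumption | rule calc_counit[where X = P] | (rule sweedler_match, (rule pull_rules)+)
      | rule rules refl)+)
  also have "\<dots> = SH h (\<lambda>h\<^sub>1 h\<^sub>2. \<epsilon>\<^bsub>H\<^esub> h\<^sub>2 \<cdot>\<^sub>s\<^bsub>P\<^esub> tens D H d h\<^sub>1)"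
    by (insert assms, (assumption | rule calc_counit[where X = P] | (rule sweedler_match, (rule pull_rules)+)
      | rule rules refl)+)
  also have "\<dots> = tens D H d h"
    by (insert assms, (assumption | rule calc_counit[where X = P] rules refl)+)
  finally show ?thesis .
qed

section \<open>Associativity and coassociativity on simple tensors\<close>

lemma mult_mult_left:
  assumes "d \<in> carrier D" "h \<in> carrier H" "e \<in> carrier D" "k \<in> carrier H" "y \<in> carrier P"
    and "SH h (\<lambda>h\<^sub>1 h\<^sub>2. SH k (\<lambda>k\<^sub>1 k\<^sub>2.
      tens D H ((d \<lhd> k\<^sub>2) \<cdot>\<^bsub>D\<^esub> (h\<^sub>1 \<rhd> e)) (h\<^sub>2 \<cdot>\<^bsub>H\<^esub> k\<^sub>1) \<cdot>\<^bsub>B\<^esub> y)) = r"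
  shows "(tens D H d h \<cdot>\<^bsub>B\<^esub> tens D H e k) \<cdot>\<^bsub>B\<^esub> y = r"
  by (rule apply_biproduct_mult[where \<phi> = "\<lambda>x. x \<cdot>\<^bsub>B\<^esub> y"])
    (insert assms, (assumption | rule calc_linear biproduct_linear)+)

lemma mult_mult_right:
  assumes "d \<in> carrier D" "h \<in> carrier H" "e \<in> carrier D" "k \<in> carrier H" "y \<in> carrier P"
    and "SH h (\<lambda>h\<^sub>1 h\<^sub>2. SH k (\<lambda>k\<^sub>1 k\<^sub>2.
      y \<cdot>\<^bsub>B\<^esub> tens D H ((d \<lhd> k\<^sub>2) \<cdot>\<^bsub>D\<^esub> (h\<^sub>1 \<rhd> e)) (h\<^sub>2 \<cdot>\<^bsub>H\<^esub> k\<^sub>1))) = r"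
  shows "y \<cdot>\<^bsub>B\<^esub> (tens D H d h \<cdot>\<^bsub>B\<^esub> tens D H e k) = r"
  by (rule apply_biproduct_mult[where \<phi> = "\<lambda>x. y \<cdot>\<^bsub>B\<^esub> x"])
    (insert assms, (assumption | rule calc_linear biproduct_linear)+)

lemma tens_mult_ract:
  assumes "c \<in> carrier D" "d \<in> carrier D" "l \<in> carrier H" "x \<in> carrier D" "g \<in> carrier H"
    and "SH l (\<lambda>l\<^sub>1 l\<^sub>2. tens D H (((c \<lhd> l\<^sub>1) \<cdot>\<^bsub>D\<^esub> (d \<lhd> l\<^sub>2)) \<cdot>\<^bsub>D\<^esub> x) g) = r"
  shows "tens D H (((c \<cdot>\<^bsub>D\<^esub> d) \<lhd> l) \<cdot>\<^bsub>D\<^esub> x) g = r"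
  unfolding mult_ract[OF assms(3,1,2)] assms(6)[symmetric]
  by (rule linear_on_sweedler_apply[where \<phi> = "\<lambda>a. tens D H (a \<cdot>\<^bsub>D\<^esub> x) g"])
    (insert assms, (assumption | rule calc_linear calc_closed refl)+)

lemma tens_mult_lact:
  assumes "c \<in> carrier D" "d \<in> carrier D" "h \<in> carrier H" "x \<in> carrier D" "g \<in> carrier H"
    and "SH h (\<lambda>h\<^sub>1 h\<^sub>2. tens D H (x \<cdot>\<^bsub>D\<^esub> ((h\<^sub>1 \<rhd> c) \<cdot>\<^bsub>D\<^esub> (h\<^sub>2 \<rhd> d))) g) = r"
  shows "tens D H (x \<cdot>\<^bsub>D\<^esub> (h \<rhd> (c \<cdot>\<^bsub>D\<^esub> d))) g = r"
  unfolding lact_mult[OF assms(3,1,2)] assms(6)[symmetric]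
  by (rule linear_on_sweedler_apply[where \<phi> = "\<lambda>a. tens D H (x \<cdot>\<^bsub>D\<^esub> a) g"])
    (insert assms, (assumption | rule calc_linear calc_closed refl)+)

abbreviation T6 :: "'d \<Rightarrow> 'h \<Rightarrow> 'd \<Rightarrow> 'h \<Rightarrow> 'd \<Rightarrow> 'h \<Rightarrow> _" where
  "T6 a p b q c r \<equiv> tens P (P \<Otimes> P) (tens D H a p) (tens P P (tens D H b q) (tens D H c r))"

text \<open>Distributing the actions over products in \<open>D\<close> and comultiplying products in
  \<open>H\<close> gives the same summand for both bracketings, once \<open>lact_ract\<close>
  interchanges the two actions. Only the nesting of the threefold comultiplications of
  \<open>h\<close>, \<open>k\<close> and \<open>l\<close> differs.\<close>

lemma biproduct_mult_assoc:
  assumes "d \<in> carrier D" "h \<in> carrier H" "e \<in> carrier D" "k \<in> carrier H" "f \<in> carrier D" "l \<in> carrier H"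
  shows "(tens D H d h \<cdot>\<^bsub>B\<^esub> tens D H e k) \<cdot>\<^bsub>B\<^esub> tens D H f l =
    tens D H d h \<cdot>\<^bsub>B\<^esub> (tens D H e k \<cdot>\<^bsub>B\<^esub> tens D H f l)"
proof -
  note expand = calc_expand[where X = "P"]
    and move = calc_move[where X = "P"]
    and rules = calc_linear calc_closed biproduct_linear
    and simps = calc_closed mult_lact ract_mult lact_ract mult_assoc
  \<comment> \<open>The product \<open>h\<^sub>2 k\<^sub>1\<close> is comultiplied again, so
    \<open>h\<close> splits on the right and \<open>k\<close> on the left; \<open>mult_ract\<close>
    splits \<open>l\<close> on the right.\<close>
  have "(tens D H d h \<cdot>\<^bsub>B\<^esub> tens D H e k) \<cdot>\<^bsub>B\<^esub> tens D H f l =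
      SH3 h (\<lambda>h\<^sub>1 h\<^sub>2 h\<^sub>3. SH k (\<lambda>r k\<^sub>3. SH r (\<lambda>k\<^sub>1 k\<^sub>2. SH3 l (\<lambda>l\<^sub>1 l\<^sub>2 l\<^sub>3.
        tens D H ((d \<lhd> k\<^sub>3 \<lhd> l\<^sub>2) \<cdot>\<^bsub>D\<^esub> ((h\<^sub>1 \<rhd> (e \<lhd> l\<^sub>3)) \<cdot>\<^bsub>D\<^esub> (h\<^sub>2 \<rhd> k\<^sub>1 \<rhd> f))) (h\<^sub>3 \<cdot>\<^bsub>H\<^esub> k\<^sub>2 \<cdot>\<^bsub>H\<^esub> l\<^sub>1)))))"
    by (insert assms, (assumption | rule expand biproduct_mult_tensI mult_mult_left tens_mult_ract
        | (rule sweedler_match, (rule pull_rules)+) | rule rules | (simp only: simps; fail))+)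
  also have "\<dots> =
      SH3 h (\<lambda>h\<^sub>1 h\<^sub>2 h\<^sub>3. SH3 k (\<lambda>k\<^sub>1 k\<^sub>2 k\<^sub>3. SH3 l (\<lambda>l\<^sub>1 l\<^sub>2 l\<^sub>3.
        tens D H ((d \<lhd> k\<^sub>3 \<lhd> l\<^sub>2) \<cdot>\<^bsub>D\<^esub> ((h\<^sub>1 \<rhd> (e \<lhd> l\<^sub>3)) \<cdot>\<^bsub>D\<^esub> (h\<^sub>2 \<rhd> k\<^sub>1 \<rhd> f))) (h\<^sub>3 \<cdot>\<^bsub>H\<^esub> k\<^sub>2 \<cdot>\<^bsub>H\<^esub> l\<^sub>1))))"
    by (insert assms, (assumption | (rule move, (rule pull_rules)+, rule trilinear_onI)
        | (rule sweedler_match, (rule pull_rules)+) | rule rules | rule refl)+)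
  \<comment> \<open>The nesting for the other bracketing: \<open>h\<close> splits on the left
    through \<open>lact_mult\<close>, and \<open>l\<close> on the left through the comultiplication
    of \<open>k\<^sub>2 l\<^sub>1\<close>.\<close>
  also have "\<dots> =
      SH h (\<lambda>r h\<^sub>3. SH r (\<lambda>h\<^sub>1 h\<^sub>2. SH3 k (\<lambda>k\<^sub>1 k\<^sub>2 k\<^sub>3. SH l (\<lambda>r l\<^sub>3.
        SH r (\<lambda>l\<^sub>1 l\<^sub>2.
        tens D H ((d \<lhd> k\<^sub>3 \<lhd> l\<^sub>2) \<cdot>\<^bsub>D\<^esub> ((h\<^sub>1 \<rhd> (e \<lhd> l\<^sub>3)) \<cdot>\<^bsub>D\<^esub> (h\<^sub>2 \<rhd> k\<^sub>1 \<rhd> f))) (h\<^sub>3 \<cdot>\<^bsub>H\<^esub> k\<^sub>2 \<cdot>\<^bsub>H\<^esub> l\<^sub>1))))))"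
    by (rule sym)
      (insert assms, (assumption | (rule move, (rule pull_rules)+, rule trilinear_onI)
        | (rule sweedler_match, (rule pull_rules)+) | rule rules | rule refl)+)
  also have "\<dots> =
      tens D H d h \<cdot>\<^bsub>B\<^esub> (tens D H e k \<cdot>\<^bsub>B\<^esub> tens D H f l)"
    by (rule sym)
      (insert assms, (assumption
        | rule expand biproduct_mult_tensI mult_mult_right tens_mult_lact
        | (rule sweedler_match, (rule pull_rules)+) | rule rules | (simp only: simps; fail))+)
  finally show ?thesis .
qed

text \<open>In the common form the comultiplications of \<open>D\<close> are outermost. Of the three
  legs of \<open>d\<close>, the first carries two right coactions, the second one of each kind, and
  the third two left coactions.\<close>

lemma biproduct_coassoc:
  assumes "d \<in> carrier D" "h \<in> carrier H"
  shows "sweedler P P (\<Delta>\<^bsub>B\<^esub> (tens D H d h)) (\<lambda>y z. sweedler P P (\<Delta>\<^bsub>B\<^esub> y) (\<lambda>y\<^sub>1 y\<^sub>2.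
      tens P (P \<Otimes> P) y\<^sub>1 (tens P P y\<^sub>2 z))) =
    sweedler P P (\<Delta>\<^bsub>B\<^esub> (tens D H d h)) (\<lambda>y z. sweedler P P (\<Delta>\<^bsub>B\<^esub> z) (\<lambda>z\<^sub>1 z\<^sub>2.
      tens P (P \<Otimes> P) y (tens P P z\<^sub>1 z\<^sub>2)))"
proof -
  note expand = calc_expand[where X = "P \<Otimes> (P \<Otimes> P)"]
    and move = calc_move[where X = "P \<Otimes> (P \<Otimes> P)"]
    and rules = calc_linear calc_closed biproduct_linear
    and simps = calc_closed mult_lact ract_mult lact_ract mult_assoc
  have "sweedler P P (\<Delta>\<^bsub>B\<^esub> (tens D H d h)) (\<lambda>y z. sweedler P P (\<Delta>\<^bsub>B\<^esub> y) (\<lambda>y\<^sub>1 y\<^sub>2.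
      tens P (P \<Otimes> P) y\<^sub>1 (tens P P y\<^sub>2 z))) =
      SD d (\<lambda>s d\<^sub>3. SH h (\<lambda>r h\<^sub>3. SH r (\<lambda>h\<^sub>1 h\<^sub>2. SR s (\<lambda>a u. SL d\<^sub>3 (\<lambda>v b.
        SD a (\<lambda>d\<^sub>1 d\<^sub>2. SH v (\<lambda>v\<^sub>1 v\<^sub>2. SR d\<^sub>1 (\<lambda>e x. SL d\<^sub>2 (\<lambda>w f.
        T6 e (w \<cdot>\<^bsub>H\<^esub> (v\<^sub>1 \<cdot>\<^bsub>H\<^esub> h\<^sub>1)) f (v\<^sub>2 \<cdot>\<^bsub>H\<^esub> (h\<^sub>2 \<cdot>\<^bsub>H\<^esub> x)) b
          (h\<^sub>3 \<cdot>\<^bsub>H\<^esub> u))))))))))"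
    by (insert assms, (assumption
        | rule expand sweedler_biproduct_comult[where X = "P \<Otimes> (P \<Otimes> P)"]
        | (rule sweedler_match, (rule pull_rules)+) | rule rules | (simp only: simps; fail))+)
  \<comment> \<open>\<open>SR_SD\<close> exposes the second comultiplication, over \<open>s\<close>,
    and multiplies \<open>g\<close> with \<open>u\<close>; \<open>SL_coassoc\<close> resolves the
    comultiplication of \<open>v\<close>.\<close>
  also have "\<dots> =
      SD d (\<lambda>s d\<^sub>3. SD s (\<lambda>d\<^sub>1 d\<^sub>2. SH3 h (\<lambda>h\<^sub>1 h\<^sub>2 h\<^sub>3. SR2 d\<^sub>1 (\<lambda>e x g.
        SL d\<^sub>2 (\<lambda>w a. SR a (\<lambda>f u. SL2 d\<^sub>3 (\<lambda>v\<^sub>1 v\<^sub>2 b.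
        T6 e (w \<cdot>\<^bsub>H\<^esub> (v\<^sub>1 \<cdot>\<^bsub>H\<^esub> h\<^sub>1)) f (v\<^sub>2 \<cdot>\<^bsub>H\<^esub> (h\<^sub>2 \<cdot>\<^bsub>H\<^esub> x)) b
          (h\<^sub>3 \<cdot>\<^bsub>H\<^esub> (g \<cdot>\<^bsub>H\<^esub> u)))))))))"
    by (insert assms, (assumption | (rule move, (rule pull_rules)+, rule trilinear_onI)
        | (rule sweedler_match, (rule pull_rules)+) | rule rules | (simp only: simps; fail))+)
  \<comment> \<open>Only now do the two comultiplications of \<open>D\<close> follow one another
    directly, so that \<open>SD_coassoc\<close> can rebracket them.\<close>
  also have "\<dots> =
      SD d (\<lambda>d\<^sub>1 s. SD s (\<lambda>d\<^sub>2 d\<^sub>3. SH3 h (\<lambda>h\<^sub>1 h\<^sub>2 h\<^sub>3. SR2 d\<^sub>1 (\<lambda>e x g.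
        SL d\<^sub>2 (\<lambda>w a. SR a (\<lambda>f u. SL2 d\<^sub>3 (\<lambda>v\<^sub>1 v\<^sub>2 b.
        T6 e (w \<cdot>\<^bsub>H\<^esub> (v\<^sub>1 \<cdot>\<^bsub>H\<^esub> h\<^sub>1)) f (v\<^sub>2 \<cdot>\<^bsub>H\<^esub> (h\<^sub>2 \<cdot>\<^bsub>H\<^esub> x)) b
          (h\<^sub>3 \<cdot>\<^bsub>H\<^esub> (g \<cdot>\<^bsub>H\<^esub> u)))))))))"
    by (insert assms, (assumption | (rule move, (rule pull_rules)+, rule trilinear_onI)
        | (rule sweedler_match, (rule pull_rules)+) | rule rules | rule refl)+)
  \<comment> \<open>The mirror reduction, started from the other side: \<open>SL_SD\<close> exposes
    the comultiplication of \<open>s\<close>, and \<open>SR_coassoc\<close> resolves that of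
    \<open>r\<close>.\<close>
  also have "\<dots> =
      SD d (\<lambda>d\<^sub>1 s. SH3 h (\<lambda>h\<^sub>1 h\<^sub>2 h\<^sub>3. SR d\<^sub>1 (\<lambda>e r. SL s (\<lambda>w a. SD a (\<lambda>d\<^sub>2 d\<^sub>3.
        SH r (\<lambda>x g. SR d\<^sub>2 (\<lambda>f u. SL d\<^sub>3 (\<lambda>v\<^sub>2 b.
        T6 e (w \<cdot>\<^bsub>H\<^esub> h\<^sub>1) f (v\<^sub>2 \<cdot>\<^bsub>H\<^esub> (h\<^sub>2 \<cdot>\<^bsub>H\<^esub> x)) b
          (h\<^sub>3 \<cdot>\<^bsub>H\<^esub> (g \<cdot>\<^bsub>H\<^esub> u))))))))))"
    by (rule sym)
      (insert assms, (assumption | (rule move, (rule pull_rules)+, rule trilinear_onI)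
        | (rule sweedler_match, (rule pull_rules)+) | rule rules | (simp only: simps; fail))+)
  also have "\<dots> =
      sweedler P P (\<Delta>\<^bsub>B\<^esub> (tens D H d h)) (\<lambda>y z. sweedler P P (\<Delta>\<^bsub>B\<^esub> z) (\<lambda>z\<^sub>1 z\<^sub>2.
      tens P (P \<Otimes> P) y (tens P P z\<^sub>1 z\<^sub>2)))"
    by (rule sym)
      (insert assms, (assumption
        | rule expand sweedler_biproduct_comult[where X = "P \<Otimes> (P \<Otimes> P)"]
        | (rule sweedler_match, (rule pull_rules)+) | rule rules | (simp only: simps; fail))+)
  finally show ?thesis .
qed

section \<open>Multiplicativity of the comultiplication on simple tensors\<close>

lemma biproduct_comult_mult:
  assumes "d \<in> carrier D" "h \<in> carrier H" "e \<in> carrier D" "k \<in> carrier H"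
  shows "\<Delta>\<^bsub>B\<^esub> (tens D H d h \<cdot>\<^bsub>B\<^esub> tens D H e k) =
    sweedler P P (\<Delta>\<^bsub>B\<^esub> (tens D H d h)) (\<lambda>x\<^sub>1 x\<^sub>2. sweedler P P (\<Delta>\<^bsub>B\<^esub> (tens D H e k)) (\<lambda>y\<^sub>1 y\<^sub>2.
      tens P P (x\<^sub>1 \<cdot>\<^bsub>B\<^esub> y\<^sub>1) (x\<^sub>2 \<cdot>\<^bsub>B\<^esub> y\<^sub>2)))"
proof -
  note expand = calc_expand[where X = "P \<Otimes> P"]
    and move = calc_move[where X = "P \<Otimes> P"]
    and rules = calc_linear calc_closed biproduct_linear
    and simps = calc_closed mult_lact ract_mult lact_ract mult_assoc
  \<comment> \<open>For each of \<open>h\<close> and \<open>k\<close>, one half of the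
    comultiplication splits through the action on \<open>D\<close>, the other through the product in
    \<open>H\<close>.\<close>
  have "\<Delta>\<^bsub>B\<^esub> (tens D H d h \<cdot>\<^bsub>B\<^esub> tens D H e k) =
      SH h (\<lambda>r s. SH r (\<lambda>h\<^sub>1 h\<^sub>2. SH s (\<lambda>h\<^sub>3 h\<^sub>4. SH k (\<lambda>r s. SH r (\<lambda>k\<^sub>1 k\<^sub>2.
        SH s (\<lambda>k\<^sub>3 k\<^sub>4. SD d (\<lambda>d\<^sub>1 d\<^sub>2. SD e (\<lambda>e\<^sub>1 e\<^sub>2. SL2 d\<^sub>2 (\<lambda>v w b.
        SR2 e\<^sub>1 (\<lambda>a x y. SL (h\<^sub>2 \<rhd> e\<^sub>2) (\<lambda>u t. SR (d\<^sub>1 \<lhd> k\<^sub>3) (\<lambda>p q.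
        T4 (p \<cdot>\<^bsub>D\<^esub> (v \<rhd> (h\<^sub>1 \<rhd> a))) (w \<cdot>\<^bsub>H\<^esub> (u \<cdot>\<^bsub>H\<^esub> (h\<^sub>3 \<cdot>\<^bsub>H\<^esub> k\<^sub>1))) (((b \<lhd> k\<^sub>4) \<lhd> y) \<cdot>\<^bsub>D\<^esub> t)
          (h\<^sub>4 \<cdot>\<^bsub>H\<^esub> (k\<^sub>2 \<cdot>\<^bsub>H\<^esub> (q \<cdot>\<^bsub>H\<^esub> x)))))))))))))))"
    by (rule apply_biproduct_mult[OF linear_biproduct_comult])
      (insert assms, (assumption | rule expand biproduct_comult_tensI
        | (rule sweedler_match, (rule pull_rules)+) | rule rules | (simp only: simps; fail))+)
  also have "\<dots> =
      SH4 h (\<lambda>h\<^sub>1 h\<^sub>2 h\<^sub>3 h\<^sub>4. SH4 k (\<lambda>k\<^sub>1 k\<^sub>2 k\<^sub>3 k\<^sub>4. SD d (\<lambda>d\<^sub>1 d\<^sub>2. SD e (\<lambda>e\<^sub>1 e\<^sub>2.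
        SL2 d\<^sub>2 (\<lambda>v w b. SR2 e\<^sub>1 (\<lambda>a x y. SL (h\<^sub>2 \<rhd> e\<^sub>2) (\<lambda>u t.
        SR (d\<^sub>1 \<lhd> k\<^sub>3) (\<lambda>p q.
        T4 (p \<cdot>\<^bsub>D\<^esub> (v \<rhd> (h\<^sub>1 \<rhd> a))) (w \<cdot>\<^bsub>H\<^esub> (u \<cdot>\<^bsub>H\<^esub> (h\<^sub>3 \<cdot>\<^bsub>H\<^esub> k\<^sub>1))) (((b \<lhd> k\<^sub>4) \<lhd> y) \<cdot>\<^bsub>D\<^esub> t)
          (h\<^sub>4 \<cdot>\<^bsub>H\<^esub> (k\<^sub>2 \<cdot>\<^bsub>H\<^esub> (q \<cdot>\<^bsub>H\<^esub> x)))))))))))"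
    by (insert assms, (assumption | (rule move, (rule pull_rules)+, rule trilinear_onI)
        | (rule sweedler_match, (rule pull_rules)+) | rule rules | rule refl)+)
  \<comment> \<open>Rebracketing makes the middle legs 2 and 3 of \<open>h\<close>, and likewise of
    \<open>k\<close>, the two legs of a single element \<open>m\<close>, the shape of
    \<open>lam_lact\<close> and \<open>rho_ract\<close>.\<close>
  also have "\<dots> =
      SH h (\<lambda>h\<^sub>1 r. SH r (\<lambda>m h\<^sub>4. SH m (\<lambda>h\<^sub>2 h\<^sub>3. SH k (\<lambda>k\<^sub>1 r. SH r (\<lambda>m k\<^sub>4.
        SH m (\<lambda>k\<^sub>2 k\<^sub>3. SD d (\<lambda>d\<^sub>1 d\<^sub>2. SD e (\<lambda>e\<^sub>1 e\<^sub>2. SL2 d\<^sub>2 (\<lambda>v w b.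
        SR2 e\<^sub>1 (\<lambda>a x y. SL (h\<^sub>2 \<rhd> e\<^sub>2) (\<lambda>u t. SR (d\<^sub>1 \<lhd> k\<^sub>3) (\<lambda>p q.
        T4 (p \<cdot>\<^bsub>D\<^esub> (v \<rhd> (h\<^sub>1 \<rhd> a))) (w \<cdot>\<^bsub>H\<^esub> (u \<cdot>\<^bsub>H\<^esub> (h\<^sub>3 \<cdot>\<^bsub>H\<^esub> k\<^sub>1))) (((b \<lhd> k\<^sub>4) \<lhd> y) \<cdot>\<^bsub>D\<^esub> t)
          (h\<^sub>4 \<cdot>\<^bsub>H\<^esub> (k\<^sub>2 \<cdot>\<^bsub>H\<^esub> (q \<cdot>\<^bsub>H\<^esub> x)))))))))))))))"
    by (rule sym)
      (insert assms, (assumption | (rule move, (rule pull_rules)+, rule trilinear_onI)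
        | (rule sweedler_match, (rule pull_rules)+) | rule rules | rule refl)+)
  \<comment> \<open>The auxiliary tensors enter here; the equation is proved from right to left,
    since the rules expand these tensors.\<close>
  also have "\<dots> =
      SH h (\<lambda>h\<^sub>1 r. SH r (\<lambda>m h\<^sub>4. SH k (\<lambda>k\<^sub>1 r. SH r (\<lambda>n k\<^sub>4. SD d (\<lambda>d\<^sub>1 d\<^sub>2.
        SD e (\<lambda>e\<^sub>1 e\<^sub>2. SL2 d\<^sub>2 (\<lambda>v w b. SR2 e\<^sub>1 (\<lambda>a x y.
        sweedler H D (lact_lam m e\<^sub>2) (\<lambda>u t. sweedler D H (ract_rho d\<^sub>1 n) (\<lambda>p q.
        T4 (p \<cdot>\<^bsub>D\<^esub> (v \<rhd> (h\<^sub>1 \<rhd> a))) (w \<cdot>\<^bsub>H\<^esub> (u \<cdot>\<^bsub>H\<^esub> k\<^sub>1)) (((b \<lhd> k\<^sub>4) \<lhd> y) \<cdot>\<^bsub>D\<^esub> t)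
          (h\<^sub>4 \<cdot>\<^bsub>H\<^esub> (q \<cdot>\<^bsub>H\<^esub> x))))))))))))"
    by (rule sym)
      (insert assms, (assumption
        | rule lact_lam_left[where X = "P \<Otimes> P"] ract_rho_left[where X = "P \<Otimes> P"]
        | (rule sweedler_match, (rule pull_rules)+)
        | rule rules lact_lam_in_carrier ract_rho_in_carrier | (simp only: simps; fail))+)
  \<comment> \<open>Expanding the same tensors the other way moves the actions out of the coactions:
    \<open>h\<^sub>3\<close> now acts on \<open>t\<close> and \<open>k\<^sub>2\<close> on
    \<open>p\<close>.\<close>
  also have "\<dots> =
      SH h (\<lambda>h\<^sub>1 r. SH r (\<lambda>m h\<^sub>4. SH m (\<lambda>h\<^sub>2 h\<^sub>3. SH k (\<lambda>k\<^sub>1 r. SH r (\<lambda>m k\<^sub>4.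
        SH m (\<lambda>k\<^sub>2 k\<^sub>3. SD d (\<lambda>d\<^sub>1 d\<^sub>2. SD e (\<lambda>e\<^sub>1 e\<^sub>2. SL2 d\<^sub>2 (\<lambda>v w b.
        SR2 e\<^sub>1 (\<lambda>a x y. SL e\<^sub>2 (\<lambda>u t. SR d\<^sub>1 (\<lambda>p q.
        T4 ((p \<lhd> k\<^sub>2) \<cdot>\<^bsub>D\<^esub> (v \<rhd> (h\<^sub>1 \<rhd> a))) (w \<cdot>\<^bsub>H\<^esub> (h\<^sub>2 \<cdot>\<^bsub>H\<^esub> (u \<cdot>\<^bsub>H\<^esub> k\<^sub>1))) (((b \<lhd> k\<^sub>4) \<lhd> y) \<cdot>\<^bsub>D\<^esub> (h\<^sub>3 \<rhd> t))
          (h\<^sub>4 \<cdot>\<^bsub>H\<^esub> (q \<cdot>\<^bsub>H\<^esub> (k\<^sub>3 \<cdot>\<^bsub>H\<^esub> x)))))))))))))))"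
    by (insert assms, (assumption
        | rule lact_lam_right[where X = "P \<Otimes> P"] ract_rho_right[where X = "P \<Otimes> P"]
        | (rule sweedler_match, (rule pull_rules)+)
        | rule rules lact_lam_in_carrier ract_rho_in_carrier | (simp only: simps; fail))+)
  also have "\<dots> =
      SH4 h (\<lambda>h\<^sub>1 h\<^sub>2 h\<^sub>3 h\<^sub>4. SH4 k (\<lambda>k\<^sub>1 k\<^sub>2 k\<^sub>3 k\<^sub>4. SD d (\<lambda>d\<^sub>1 d\<^sub>2. SD e (\<lambda>e\<^sub>1 e\<^sub>2.
        SL2 d\<^sub>2 (\<lambda>v w b. SR2 e\<^sub>1 (\<lambda>a x y. SL e\<^sub>2 (\<lambda>u t. SR d\<^sub>1 (\<lambda>p q.
        T4 ((p \<lhd> k\<^sub>2) \<cdot>\<^bsub>D\<^esub> (v \<rhd> (h\<^sub>1 \<rhd> a))) (w \<cdot>\<^bsub>H\<^esub> (h\<^sub>2 \<cdot>\<^bsub>H\<^esub> (u \<cdot>\<^bsub>H\<^esub> k\<^sub>1))) (((b \<lhd> k\<^sub>4) \<lhd> y) \<cdot>\<^bsub>D\<^esub> (h\<^sub>3 \<rhd> t))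
          (h\<^sub>4 \<cdot>\<^bsub>H\<^esub> (q \<cdot>\<^bsub>H\<^esub> (k\<^sub>3 \<cdot>\<^bsub>H\<^esub> x)))))))))))"
    by (insert assms, (assumption | (rule move, (rule pull_rules)+, rule trilinear_onI)
        | (rule sweedler_match, (rule pull_rules)+) | rule rules | rule refl)+)
  \<comment> \<open>The sum over a pure tensor marks the places of \<open>p\<close> and
    \<open>t\<close>, in which the last condition is to be substituted.\<close>
  also have "\<dots> =
      SH4 h (\<lambda>h\<^sub>1 h\<^sub>2 h\<^sub>3 h\<^sub>4. SH4 k (\<lambda>k\<^sub>1 k\<^sub>2 k\<^sub>3 k\<^sub>4. SD d (\<lambda>d\<^sub>1 d\<^sub>2. SD e (\<lambda>e\<^sub>1 e\<^sub>2.
        SL2 d\<^sub>2 (\<lambda>v w b. SR2 e\<^sub>1 (\<lambda>a x y. SL e\<^sub>2 (\<lambda>u t. SR d\<^sub>1 (\<lambda>p q.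
        sweedler D D (tens D D p t) (\<lambda>i j.
        T4 ((i \<lhd> k\<^sub>2) \<cdot>\<^bsub>D\<^esub> (v \<rhd> (h\<^sub>1 \<rhd> a))) (w \<cdot>\<^bsub>H\<^esub> (h\<^sub>2 \<cdot>\<^bsub>H\<^esub> (u \<cdot>\<^bsub>H\<^esub> k\<^sub>1))) (((b \<lhd> k\<^sub>4) \<lhd> y) \<cdot>\<^bsub>D\<^esub> (h\<^sub>3 \<rhd> j))
          (h\<^sub>4 \<cdot>\<^bsub>H\<^esub> (q \<cdot>\<^bsub>H\<^esub> (k\<^sub>3 \<cdot>\<^bsub>H\<^esub> x))))))))))))"
    by (rule sym)
      (insert assms, (assumption | rule sweedler_of_tens[where X = "P \<Otimes> P"]
        | (rule sweedler_match, (rule pull_rules)+) | rule rules | rule refl)+)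
  \<comment> \<open>That condition is read from right to left: it creates a further coaction on
    \<open>p\<close> and on \<open>t\<close>, hence twofold coactions on \<open>d\<^sub>1\<close>
    and \<open>e\<^sub>2\<close>.\<close>
  also have "\<dots> =
      SH4 h (\<lambda>h\<^sub>1 h\<^sub>2 h\<^sub>3 h\<^sub>4. SH4 k (\<lambda>k\<^sub>1 k\<^sub>2 k\<^sub>3 k\<^sub>4. SD d (\<lambda>d\<^sub>1 d\<^sub>2. SD e (\<lambda>e\<^sub>1 e\<^sub>2.
        SL2 d\<^sub>2 (\<lambda>v w b. SR2 e\<^sub>1 (\<lambda>a x y. SR2 d\<^sub>1 (\<lambda>i f q. SL2 e\<^sub>2 (\<lambda>u g j.
        T4 (((i \<lhd> g) \<lhd> k\<^sub>2) \<cdot>\<^bsub>D\<^esub> (v \<rhd> (h\<^sub>1 \<rhd> a))) (w \<cdot>\<^bsub>H\<^esub> (h\<^sub>2 \<cdot>\<^bsub>H\<^esub> (u \<cdot>\<^bsub>H\<^esub> k\<^sub>1))) (((b \<lhd> k\<^sub>4) \<lhd> y) \<cdot>\<^bsub>D\<^esub> (h\<^sub>3 \<rhd> (f \<rhd> j)))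
          (h\<^sub>4 \<cdot>\<^bsub>H\<^esub> (q \<cdot>\<^bsub>H\<^esub> (k\<^sub>3 \<cdot>\<^bsub>H\<^esub> x)))))))))))"
    by (insert assms, (assumption | rule SR_ract_SL_lact[where X = "P \<Otimes> P"]
        | (rule sweedler_match, (rule pull_rules)+) | rule rules | (simp only: simps; fail))+)
  \<comment> \<open>The twofold coactions become comultiplied coaction components, and
    \<open>h\<close> and \<open>k\<close> are grouped in pairs, as the products in the two tensor
    factors require.\<close>
  also have "\<dots> =
      SH h (\<lambda>r s. SH r (\<lambda>h\<^sub>1 h\<^sub>2. SH s (\<lambda>h\<^sub>3 h\<^sub>4. SH k (\<lambda>r s. SH r (\<lambda>k\<^sub>1 k\<^sub>2.
        SH s (\<lambda>k\<^sub>3 k\<^sub>4. SD d (\<lambda>d\<^sub>1 d\<^sub>2. SD e (\<lambda>e\<^sub>1 e\<^sub>2. SL d\<^sub>2 (\<lambda>r b.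
        SH r (\<lambda>v w. SR e\<^sub>1 (\<lambda>a r. SH r (\<lambda>x y. SL e\<^sub>2 (\<lambda>s j. SH s (\<lambda>u g.
        SR d\<^sub>1 (\<lambda>i s. SH s (\<lambda>f q.
        T4 (((i \<lhd> g) \<lhd> k\<^sub>2) \<cdot>\<^bsub>D\<^esub> (v \<rhd> (h\<^sub>1 \<rhd> a))) (w \<cdot>\<^bsub>H\<^esub> (h\<^sub>2 \<cdot>\<^bsub>H\<^esub> (u \<cdot>\<^bsub>H\<^esub> k\<^sub>1))) (((b \<lhd> k\<^sub>4) \<lhd> y) \<cdot>\<^bsub>D\<^esub> (h\<^sub>3 \<rhd> (f \<rhd> j)))
          (h\<^sub>4 \<cdot>\<^bsub>H\<^esub> (q \<cdot>\<^bsub>H\<^esub> (k\<^sub>3 \<cdot>\<^bsub>H\<^esub> x)))))))))))))))))))"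
    by (rule sym)
      (insert assms, (assumption | (rule move, (rule pull_rules)+, rule trilinear_onI)
        | (rule sweedler_match, (rule pull_rules)+) | rule rules | rule refl)+)
  also have "\<dots> =
      sweedler P P (\<Delta>\<^bsub>B\<^esub> (tens D H d h)) (\<lambda>x\<^sub>1 x\<^sub>2. sweedler P P (\<Delta>\<^bsub>B\<^esub> (tens D H e k)) (\<lambda>y\<^sub>1 y\<^sub>2.
      tens P P (x\<^sub>1 \<cdot>\<^bsub>B\<^esub> y\<^sub>1) (x\<^sub>2 \<cdot>\<^bsub>B\<^esub> y\<^sub>2)))"
    by (rule sym)
      (insert assms, (assumption
        | rule expand sweedler_biproduct_comult[where X = "P \<Otimes> P"] tens_mult_left tens_mult_right
        | (rule sweedler_match, (rule pull_rules)+) | rule rules | (simp only: simps; fail))+)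
  finally show ?thesis .
qed

text \<open>All four sums run over pure tensors. The coactions first stand at bound variables, so
  \<open>rho_one\<close> and \<open>lam_one\<close> can enter only after the outer sums are
  evaluated; \<open>sweedler_eqD\<close> supplies them then.\<close>

lemma biproduct_comult_one: "\<Delta>\<^bsub>B\<^esub> (tens D H \<one>\<^bsub>D\<^esub> \<one>\<^bsub>H\<^esub>) = T4 \<one>\<^bsub>D\<^esub> \<one>\<^bsub>H\<^esub> \<one>\<^bsub>D\<^esub> \<one>\<^bsub>H\<^esub>"
  by (rule biproduct_comult_tensI, (fact unit_closed)+, unfold comult_one comult_H_one)
    (insert unit_closed, (assumption | rule sweedler_of_tens[where X = "P \<Otimes> P"]
        sweedler_eqD[OF rho_one[symmetric]] sweedler_eqD[OF lam_one[symmetric]] calc_linear calc_closed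
      | (simp only: mult_one unit_closed; fail))+)

section \<open>Extension of the axioms from simple tensors to the whole space\<close>

lemma algebra_biproduct: "algebra B"
  unfolding algebra_def biproduct_space
proof (intro conjI ballI)
  show "vspace B" "bilinear_on P P P (mult B)"
    by (fact vspace_biproduct bilinear_biproduct_mult)+
  show "tens D H \<one>\<^bsub>D\<^esub> \<one>\<^bsub>H\<^esub> \<in> carrier P"
    by (insert unit_closed, (assumption | rule calc_closed)+)
  note rules = calc_linear biproduct_linear calc_closed unit_closed
  fix x assume x: "x \<in> carrier P"
  show "tens D H \<one>\<^bsub>D\<^esub> \<one>\<^bsub>H\<^esub> \<cdot>\<^bsub>B\<^esub> x = x" "x \<cdot>\<^bsub>B\<^esub> tens D H \<one>\<^bsub>D\<^esub> \<one>\<^bsub>H\<^esub> = x"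
    by (rule linear_on_tensor_eqI[OF structure_simps(2,1) _ _ _ x, where X = P];
      (assumption | rule rules biproduct_one_left biproduct_one_right)+)+
  fix y z assume "y \<in> carrier P" "z \<in> carrier P"
  from x this show "(x \<cdot>\<^bsub>B\<^esub> y) \<cdot>\<^bsub>B\<^esub> z = x \<cdot>\<^bsub>B\<^esub> (y \<cdot>\<^bsub>B\<^esub> z)"
    by (rule trilinear_on_tensor_eqI[OF structure_simps(2,1,2,1,2,1), where X = P, rotated -3])
      (assumption | rule rules biproduct_mult_assoc)+
qed

lemma coalgebra_biproduct: "coalgebra B"
  unfolding coalgebra_def biproduct_space
proof (intro conjI ballI)
  show "vspace B" "linear_on P (P \<Otimes> P) \<Delta>\<^bsub>B\<^esub>" "linear_on P scalars \<epsilon>\<^bsub>B\<^esub>"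
    by (fact vspace_biproduct linear_biproduct_comult linear_biproduct_counit)+
  note rules = calc_linear biproduct_linear calc_closed calc_smult
  fix x assume x: "x \<in> carrier P"
  show "sweedler P P (\<Delta>\<^bsub>B\<^esub> x) (\<lambda>y z. \<epsilon>\<^bsub>B\<^esub> y \<cdot>\<^sub>s\<^bsub>P\<^esub> z) = x"
    "sweedler P P (\<Delta>\<^bsub>B\<^esub> x) (\<lambda>y z. \<epsilon>\<^bsub>B\<^esub> z \<cdot>\<^sub>s\<^bsub>P\<^esub> y) = x"
    by (rule linear_on_tensor_eqI[OF structure_simps(2,1) _ _ _ x, where X = P];
      (assumption | rule rules biproduct_counit_left biproduct_counit_right)+)+
  let ?f = "\<lambda>x. sweedler P P (\<Delta>\<^bsub>B\<^esub> x) (\<lambda>y z. sweedler P P (\<Delta>\<^bsub>B\<^esub> y) (\<lambda>y\<^sub>1 y\<^sub>2.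
      tens P (P \<Otimes> P) y\<^sub>1 (tens P P y\<^sub>2 z)))"
    and ?g = "\<lambda>x. sweedler P P (\<Delta>\<^bsub>B\<^esub> x) (\<lambda>y z. sweedler P P (\<Delta>\<^bsub>B\<^esub> z) (\<lambda>z\<^sub>1 z\<^sub>2.
      tens P (P \<Otimes> P) y (tens P P z\<^sub>1 z\<^sub>2)))"
  show "?f x = ?g x"
    \<comment> \<open>Both maps are given explicitly, so that abstracting over \<open>x\<close> is
      not left to unification.\<close>
    by (rule linear_on_tensor_eqI[OF structure_simps(2,1) _ _ _ x,
          where X = "P \<Otimes> (P \<Otimes> P)" and f = ?f and g = ?g])
      (assumption | rule rules biproduct_coassoc)+
qed

lemma bialgebra_biproduct: "bialgebra B"
  unfolding bialgebra_def biproduct_space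
proof (intro conjI ballI)
  note rules = calc_linear biproduct_linear calc_closed
    bilinear_on_scalar_mult[THEN linear_on_fun_left] bilinear_on_scalar_mult[THEN linear_on_fun_right]
  show "algebra B" "coalgebra B" "\<Delta>\<^bsub>B\<^esub> (tens D H \<one>\<^bsub>D\<^esub> \<one>\<^bsub>H\<^esub>) = T4 \<one>\<^bsub>D\<^esub> \<one>\<^bsub>H\<^esub> \<one>\<^bsub>D\<^esub> \<one>\<^bsub>H\<^esub>"
    by (fact algebra_biproduct coalgebra_biproduct biproduct_comult_one)+
  show "\<epsilon>\<^bsub>B\<^esub> (tens D H \<one>\<^bsub>D\<^esub> \<one>\<^bsub>H\<^esub>) = 1"
    by (simp add: biproduct_counit_tens unit_closed counit_one counit_eqs)
  fix x y assume xy: "x \<in> carrier P" "y \<in> carrier P"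
  show "\<epsilon>\<^bsub>B\<^esub> (x \<cdot>\<^bsub>B\<^esub> y) = \<epsilon>\<^bsub>B\<^esub> x * \<epsilon>\<^bsub>B\<^esub> y"
    by (rule bilinear_on_tensor_eqI[OF structure_simps(2,1,2,1) _ _ _ xy, where X = scalars])
      (assumption | rule rules biproduct_counit_mult)+
  let ?f = "\<lambda>x y. \<Delta>\<^bsub>B\<^esub> (x \<cdot>\<^bsub>B\<^esub> y)"
    and ?g = "\<lambda>x y. sweedler P P (\<Delta>\<^bsub>B\<^esub> x) (\<lambda>x\<^sub>1 x\<^sub>2. sweedler P P (\<Delta>\<^bsub>B\<^esub> y) (\<lambda>y\<^sub>1 y\<^sub>2.
        tens P P (x\<^sub>1 \<cdot>\<^bsub>B\<^esub> y\<^sub>1) (x\<^sub>2 \<cdot>\<^bsub>B\<^esub> y\<^sub>2)))"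
  show "?f x y = ?g x y"
    by (rule bilinear_on_tensor_eqI[OF structure_simps(2,1,2,1) _ _ _ xy,
          where X = "P \<Otimes> P" and f = ?f and g = ?g])
      (assumption | rule rules biproduct_comult_mult)+
qed

end

theorem theorem1p1:
  fixes H :: "('k::field, 'h::ab_group_add) alg_coalg"
    and D :: "('k, 'd::ab_group_add) alg_coalg"
    and lact :: "'h \<Rightarrow> 'd \<Rightarrow> 'd" and ract :: "'d \<Rightarrow> 'h \<Rightarrow> 'd"
    and rho :: "'d \<Rightarrow> ('k, 'd, 'h) tensor" and lam :: "'d \<Rightarrow> ('k, 'h, 'd) tensor"
  assumes "bialgebra H"
    and "LR_admissible_pair H D lact ract rho lam"
  shows "bialgebra (LR_smash_biproduct H D lact ract rho lam)"
  using assms(2) by (rule LR_admissible_pair.bialgebra_biproduct)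

end
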